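(* Suppose that the standing assumption (A) on $(f,g,h,c)$ stated in the context holds, that $\operatorname{dom} h=\mathbb{R}^m$ and $\operatorname{dom} g$ is compact, and that $\{\beta_t\}$ satisfies the growth conditions (B) stated in the context with $\delta=0.5$ and some constants $\alpha_0,\gamma_0,\eta_0$. Let $\{x^t\}$, $\{y^t\}$ be generated by Algorithm SDCAM$_{1\ell}$ described in the context. Then the iteration complexity of the algorithm for obtaining an $(\epsilon,\epsilon,\epsilon)$-stationary point is $\tilde{\mathcal{O}}(\epsilon^{-4})$; that is, there are constants $C>0$ and $\kappa\ge0$, independent of $\epsilon$, such that for every $\epsilon\in(0,\frac12)$ some $x^{t+1}$ with $1\le t\le \lceil C\epsilon^{-4}(\ln(1/\epsilon))^\kappa\rceil$ is an $(\epsilon,\epsilon,\epsilon)$-stationary point.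
   Context: Problem: $\min_{x\in\mathbb{R}^n} F(x):=f(x)+g(x)+h(c(x))$, with $f:\mathbb{R}^n\to\mathbb{R}$, $g:\mathbb{R}^n\to(-\infty,\infty]$, $h:\mathbb{R}^m\to(-\infty,\infty]$, $c:\mathbb{R}^n\to\mathbb{R}^m$, and $F$ proper. $\|\cdot\|$ is the Euclidean norm (operator norm for linear maps); $J_c(x)$ is the Jacobian of $c$ at $x$; $\operatorname{dom}\varphi=\{x:\varphi(x)<\infty\}$; ``closed function'' means lower semicontinuous. Definition: for $\epsilon_1,\epsilon_2>0$, $\epsilon_3\ge0$, a point $x\in\operatorname{dom} g$ is an $(\epsilon_1,\epsilon_2,\epsilon_3)$-stationary point if there exist $y\in\mathbb{R}^m$ and $z\in\mathbb{R}^n$ with ${\rm dist}(0,\nabla f(x)+\partial g(x)+J_c(z)^T\partial h(y))\le\epsilon_1$, $\|c(x)-y\|\le\epsilon_2$, $\|x-z\|\le\epsilon_3$. Standing assumption (A): (i) $f$ is differentiable and $\|\nabla f(x)-\nabla f(z)\|\le L\|x-z\|$ for all $x,z\in\mathbb{R}^n$, for some $L>0$. (ii) $c$ is continuously differentiable on $\mathbb{R}^n$ and there are $L_c>0$, $M_c>0$ with $\|J_c(x)-J_c(z)\|\le L_c\|x-z\|$ and $\|J_c(x)\|\le M_c$ for all $x,z$ in the closure of the convex hull of $\operatorname{dom} g$. (iii) $g$ and $h$ are proper closed functions, continuous on their domains; $\operatorname{dom} g$ and $\operatorname{dom} h$ are closed; $\operatorname{dom} g\cap c^{-1}(\operatorname{dom}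 h)\ne\emptyset$; the proximal mappings of $\gamma g$ and $\gamma h$ are easy to compute for every $\gamma>0$; $\inf\{f+g\}>-\infty$ and $\inf h\ge 0$. Proximal mapping: ${\rm Prox}_{\gamma\varphi}(x):={\rm Argmin}_u\{\frac1{2\gamma}\|x-u\|^2+\varphi(u)\}$ (a set). Algorithm SDCAM$_{1\ell}$: Choose $\mu_{\max}>\mu_{-1}>0$, $\rho\in(0,1)$, $\eta\ge1$, $x^0\in\operatorname{dom} g$, $y^0\in\operatorname{dom} h$, and a positive nondecreasing sequence $\{\beta_t\}_{t\ge0}$ with $\beta_t\to\infty$, $\beta_t/\beta_{t-1}\to1$. Start with $t=0$, $\mu=\mu_{-1}$. Repeat: pick $$\tilde x\in{\rm Argmin}_{x\in\mathbb{R}^n}\{\langle\nabla f(x^t)+\beta_tJ_c(x^t)^T(c(x^t)-y^t),x\rangle+\tfrac1\mu\|x-x^t\|^2+g(x)\}.$$ If both (a) $\|c(\tilde x)-c(x^t)\|\le\sqrt{\frac1{\mu\beta_t}}\|\tilde x-x^t\|$ and (b) $f(\tilde x)+g(\tilde x)+\frac{\beta_t}2\|c(\tilde x)-y^t\|^2\le f(x^t)+g(x^t)+\frac{\beta_t}2\|c(x^t)-y^t\|^2-\frac1{2\mu}\|\tilde x-x^t\|^2$ hold, then (successful iteration) set $x^{t+1}=\tilde x$, $\mu_t=\mu$, pick $y^{t+1}\in{\rm Prox}_{(1/\beta_t)h}(c(x^{t+1}))$, replace $t$ by $t+1$ and $\mu$ by $\min\{\mu_{\max},\eta\mu\}$;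 otherwise (unsuccessful iteration) replace $\mu$ by $\rho\mu$. The generated sequences are the infinite sequences $\{x^t\},\{y^t\},\{\mu_t\}$; iterations are counted by the index $t$. Growth conditions (B): there are $\delta\in(0,1)$ and positive constants $\alpha_0\le\gamma_0$ and $\eta_0$ with $\alpha_0(t+1)^\delta\le\beta_t\le\gamma_0(t+1)^\delta$ for all $t\ge0$ and $0\le\beta_t-\beta_{t-1}\le\eta_0t^{\delta-1}$ for all $t\ge1$. Subdifferentials: for a proper closed $\varphi$ and $\bar x\in\operatorname{dom}\varphi$, $v\in\widehat\partial\varphi(\bar x)$ iff $\liminf_{x\to\bar x,x\ne\bar x}\frac{\varphi(x)-\varphi(\bar x)-\langle v,x-\bar x\rangle}{\|x-\bar x\|}\ge0$; the limiting subdifferential $\partial\varphi(\bar x)$ is the set of limits of $v^t\in\widehat\partial\varphi(x^t)$ with $x^t\to\bar x$, $\varphi(x^t)\to\varphi(\bar x)$. ${\rm dist}(0,S)$ is the Euclidean distance from $0$ to the set $S$. *)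

theory Defs
  imports "HOL-Analysis.Analysis"
begin

section \<open>Extended-real-valued functions\<close>

definition edom :: "('a \<Rightarrow> ereal) \<Rightarrow> 'a set" where
  "edom \<phi> = {x. \<phi> x < \<infinity>}"

definition proper :: "('a \<Rightarrow> ereal) \<Rightarrow> bool" where
  "proper \<phi> \<longleftrightarrow> (\<forall>x. \<phi> x \<noteq> -\<infinity>) \<and> edom \<phi> \<noteq> {}"

definition lsc :: "('a::topological_space \<Rightarrow> ereal) \<Rightarrow> bool" where
  "lsc \<phi> \<longleftrightarrow> (\<forall>x. \<phi> x \<le> Liminf (at x) \<phi>)"

definition Argmin :: "('a \<Rightarrow> ereal) \<Rightarrow> 'a set" where
  "Argmin \<phi> = {u. \<forall>v. \<phi> u \<le> \<phi> v}"

definition Prox :: "real \<Rightarrow> ('a::real_normed_vector \<Rightarrow> ereal) \<Rightarrow> 'a \<Rightarrow> 'a set" where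
  "Prox \<gamma> \<phi> x = Argmin (\<lambda>u. ereal (1 / (2 * \<gamma>) * (norm (x - u))\<^sup>2) + \<phi> u)"

text \<open>Both subdifferentials are empty outside the domain.\<close>

definition regular_subdiff :: "('a::real_inner \<Rightarrow> ereal) \<Rightarrow> 'a \<Rightarrow> 'a set" where
  "regular_subdiff \<phi> a = {v. a \<in> edom \<phi> \<and>
     0 \<le> Liminf (at a) (\<lambda>x. (\<phi> x - \<phi> a - ereal (v \<bullet> (x - a))) / ereal (norm (x - a)))}"

definition limiting_subdiff :: "('a::real_inner \<Rightarrow> ereal) \<Rightarrow> 'a \<Rightarrow> 'a set" where
  "limiting_subdiff \<phi> a = {v. a \<in> edom \<phi> \<and>
     (\<exists>xs vs. (\<forall>t::nat. vs t \<in> regular_subdiff \<phi> (xs t)) \<and>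
       xs \<longlonglongrightarrow> a \<and> (\<lambda>t. \<phi> (xs t)) \<longlonglongrightarrow> \<phi> a \<and> vs \<longlonglongrightarrow> v)}"

text \<open>The distance to the empty set is infinite here, whereas the library's \<open>infdist\<close>
  returns zero in that case.\<close>

definition edist_set :: "'a::metric_space \<Rightarrow> 'a set \<Rightarrow> ereal" where
  "edist_set a S = (INF s\<in>S. ereal (dist a s))"


section \<open>The problem data\<close>

definition grad :: "('a::real_inner \<Rightarrow> real) \<Rightarrow> 'a \<Rightarrow> 'a" where
  "grad f x = (THE D. GDERIV f x :> D)"

abbreviation Jac :: "(real^'n \<Rightarrow> real^'m) \<Rightarrow> real^'n \<Rightarrow> real^'n^'m" where
  "Jac c x \<equiv> jacobian c (at x)"

definition opnorm :: "real^'n^'m \<Rightarrow> real" where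
  "opnorm A = onorm (\<lambda>v. A *v v)"

definition objective ::
  "(real^'n \<Rightarrow> real) \<Rightarrow> (real^'n \<Rightarrow> ereal) \<Rightarrow> (real^'m \<Rightarrow> ereal) \<Rightarrow> (real^'n \<Rightarrow> real^'m)
    \<Rightarrow> real^'n \<Rightarrow> ereal" where
  "objective f g h c x = ereal (f x) + g x + h (c x)"

definition standing_assumption ::
  "(real^'n \<Rightarrow> real) \<Rightarrow> (real^'n \<Rightarrow> ereal) \<Rightarrow> (real^'m \<Rightarrow> ereal) \<Rightarrow> (real^'n \<Rightarrow> real^'m)
    \<Rightarrow> bool" where
  "standing_assumption f g h c \<longleftrightarrow>
     proper (objective f g h c) \<and>
     (\<forall>x. f differentiable (at x)) \<and>
     (\<exists>L>0. \<forall>x z. norm (grad f x - grad f z) \<le> L * norm (x - z)) \<and>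
     (\<forall>x. c differentiable (at x)) \<and> continuous_on UNIV (\<lambda>x. Jac c x) \<and>
     (\<exists>L\<^sub>c>0. \<exists>M\<^sub>c>0. \<forall>x \<in> closure (convex hull (edom g)). \<forall>z \<in> closure (convex hull (edom g)).
        opnorm (Jac c x - Jac c z) \<le> L\<^sub>c * norm (x - z) \<and> opnorm (Jac c x) \<le> M\<^sub>c) \<and>
     proper g \<and> lsc g \<and> continuous_on (edom g) g \<and> closed (edom g) \<and>
     proper h \<and> lsc h \<and> continuous_on (edom h) h \<and> closed (edom h) \<and>
     edom g \<inter> c -` edom h \<noteq> {} \<and>
     (INF x. ereal (f x) + g x) > -\<infinity> \<and>
     (INF y. h y) \<ge> 0"

definition stationary_point ::
  "(real^'n \<Rightarrow> real) \<Rightarrow> (real^'n \<Rightarrow> ereal) \<Rightarrow> (real^'m \<Rightarrow> ereal) \<Rightarrow> (real^'n \<Rightarrow> real^'m)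
    \<Rightarrow> real \<Rightarrow> real \<Rightarrow> real \<Rightarrow> real^'n \<Rightarrow> bool" where
  "stationary_point f g h c \<epsilon>\<^sub>1 \<epsilon>\<^sub>2 \<epsilon>\<^sub>3 x \<longleftrightarrow> x \<in> edom g \<and>
     (\<exists>y z. edist_set 0 {grad f x + u + transpose (Jac c z) *v w | u w.
                u \<in> limiting_subdiff g x \<and> w \<in> limiting_subdiff h y} \<le> ereal \<epsilon>\<^sub>1 \<and>
            norm (c x - y) \<le> \<epsilon>\<^sub>2 \<and> norm (x - z) \<le> \<epsilon>\<^sub>3)"


section \<open>The algorithm\<close>

definition subproblem ::
  "(real^'n \<Rightarrow> real) \<Rightarrow> (real^'n \<Rightarrow> ereal) \<Rightarrow> (real^'n \<Rightarrow> real^'m) \<Rightarrow> real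
    \<Rightarrow> real^'n \<Rightarrow> real^'m \<Rightarrow> real \<Rightarrow> real^'n \<Rightarrow> ereal" where
  "subproblem f g c b x y \<mu> u =
     ereal ((grad f x + b *\<^sub>R (transpose (Jac c x) *v (c x - y))) \<bullet> u
            + 1 / \<mu> * (norm (u - x))\<^sup>2) + g u"

definition accepted ::
  "(real^'n \<Rightarrow> real) \<Rightarrow> (real^'n \<Rightarrow> ereal) \<Rightarrow> (real^'n \<Rightarrow> real^'m) \<Rightarrow> real
    \<Rightarrow> real^'n \<Rightarrow> real^'m \<Rightarrow> real \<Rightarrow> real^'n \<Rightarrow> bool" where
  "accepted f g c b x y \<mu> u \<longleftrightarrow>
     norm (c u - c x) \<le> sqrt (1 / (\<mu> * b)) * norm (u - x) \<and>
     ereal (f u) + g u + ereal (b / 2 * (norm (c u - y))\<^sup>2)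
       \<le> ereal (f x) + g x + ereal (b / 2 * (norm (c x - y))\<^sup>2)
          - ereal (1 / (2 * \<mu>) * (norm (u - x))\<^sup>2)"

text \<open>\<open>search f g c b \<rho> x y \<mu> u \<mu>'\<close>: from the iterate \<open>(x, y)\<close> and the trial step size
  \<open>\<mu>\<close>, finitely many (possibly zero) unsuccessful iterations followed by a successful one may
  produce the new iterate \<open>u\<close> with accepted step size \<open>\<mu>'\<close>. Each minimizer is chosen
  arbitrarily from the solution set.\<close>

inductive search ::
  "(real^'n \<Rightarrow> real) \<Rightarrow> (real^'n \<Rightarrow> ereal) \<Rightarrow> (real^'n \<Rightarrow> real^'m) \<Rightarrow> real \<Rightarrow> real
    \<Rightarrow> real^'n \<Rightarrow> real^'m \<Rightarrow> real \<Rightarrow> real^'n \<Rightarrow> real \<Rightarrow> bool"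
  for f g c b \<rho> x y where
  success: "u \<in> Argmin (subproblem f g c b x y \<mu>) \<Longrightarrow> accepted f g c b x y \<mu> u
    \<Longrightarrow> search f g c b \<rho> x y \<mu> u \<mu>"
| failure: "v \<in> Argmin (subproblem f g c b x y \<mu>) \<Longrightarrow> \<not> accepted f g c b x y \<mu> v
    \<Longrightarrow> search f g c b \<rho> x y (\<rho> * \<mu>) u \<mu>'
    \<Longrightarrow> search f g c b \<rho> x y \<mu> u \<mu>'"

text \<open>The argument \<open>\<mu>\<^sub>0\<close> is the initial step size, conventionally indexed by \<open>-1\<close>.\<close>

definition sdcam_parameters ::
  "real \<Rightarrow> real \<Rightarrow> real \<Rightarrow> real \<Rightarrow> (nat \<Rightarrow> real) \<Rightarrow> bool" where
  "sdcam_parameters \<mu>\<^sub>m\<^sub>a\<^sub>x \<mu>\<^sub>0 \<rho> \<eta> \<beta> \<longleftrightarrow>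
     \<mu>\<^sub>m\<^sub>a\<^sub>x > \<mu>\<^sub>0 \<and> \<mu>\<^sub>0 > 0 \<and> 0 < \<rho> \<and> \<rho> < 1 \<and> \<eta> \<ge> 1 \<and>
     (\<forall>t. \<beta> t > 0) \<and> incseq \<beta> \<and> filterlim \<beta> at_top sequentially \<and>
     (\<lambda>t. \<beta> (Suc t) / \<beta> t) \<longlonglongrightarrow> 1"

definition sdcam_generated ::
  "(real^'n \<Rightarrow> real) \<Rightarrow> (real^'n \<Rightarrow> ereal) \<Rightarrow> (real^'m \<Rightarrow> ereal) \<Rightarrow> (real^'n \<Rightarrow> real^'m)
    \<Rightarrow> real \<Rightarrow> real \<Rightarrow> real \<Rightarrow> real \<Rightarrow> (nat \<Rightarrow> real)
    \<Rightarrow> (nat \<Rightarrow> real^'n) \<Rightarrow> (nat \<Rightarrow> real^'m) \<Rightarrow> (nat \<Rightarrow> real) \<Rightarrow> bool" where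
  "sdcam_generated f g h c \<mu>\<^sub>m\<^sub>a\<^sub>x \<mu>\<^sub>0 \<rho> \<eta> \<beta> x y \<mu> \<longleftrightarrow>
     x 0 \<in> edom g \<and> y 0 \<in> edom h \<and>
     search f g c (\<beta> 0) \<rho> (x 0) (y 0) \<mu>\<^sub>0 (x 1) (\<mu> 0) \<and>
     (\<forall>t. search f g c (\<beta> (Suc t)) \<rho> (x (Suc t)) (y (Suc t)) (min \<mu>\<^sub>m\<^sub>a\<^sub>x (\<eta> * \<mu> t))
            (x (Suc (Suc t))) (\<mu> (Suc t))) \<and>
     (\<forall>t. y (Suc t) \<in> Prox (1 / \<beta> t) h (c (x (Suc t))))"

definition growth_condition ::
  "real \<Rightarrow> real \<Rightarrow> real \<Rightarrow> real \<Rightarrow> (nat \<Rightarrow> real) \<Rightarrow> bool" where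
  "growth_condition \<delta> \<alpha>\<^sub>0 \<gamma>\<^sub>0 \<eta>\<^sub>0 \<beta> \<longleftrightarrow>
     0 < \<delta> \<and> \<delta> < 1 \<and> 0 < \<alpha>\<^sub>0 \<and> \<alpha>\<^sub>0 \<le> \<gamma>\<^sub>0 \<and> 0 < \<eta>\<^sub>0 \<and>
     (\<forall>t. \<alpha>\<^sub>0 * real (t + 1) powr \<delta> \<le> \<beta> t \<and> \<beta> t \<le> \<gamma>\<^sub>0 * real (t + 1) powr \<delta>) \<and>
     (\<forall>t\<ge>1. 0 \<le> \<beta> t - \<beta> (t - 1) \<and> \<beta> t - \<beta> (t - 1) \<le> \<eta>\<^sub>0 * real t powr (\<delta> - 1))"

end

theory Submission
  imports Defs
begin

text \<open>
  A trial step is accepted as soon as \<open>\<mu>\<close> is below a fixed multiple of \<open>1 / \<beta> t\<close>, by the quadratic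
  upper bounds for \<open>f\<close> and for \<open>\<parallel>c - y\<parallel>\<^sup>2\<close>; hence \<open>\<mu> t \<ge> k / \<beta> t\<close>. The proximal step gives
  \<open>\<beta> t \<parallel>c (x (t + 1)) - y (t + 1)\<parallel>\<^sup>2 = O(1)\<close>, because \<open>h \<circ> c\<close> is bounded on the compact domain of \<open>g\<close>.
  The potential \<open>f + g + \<beta> t / 2 \<parallel>c - y\<parallel>\<^sup>2 + h\<close> is therefore bounded, decreases by
  \<open>\<parallel>x (t + 1) - x t\<parallel>\<^sup>2 / (2 \<mu> t)\<close> in each step, and increases only by \<open>O(1 / t)\<close> when the penalty grows.
  These increases sum to \<open>O(1)\<close> over a dyadic window \<open>T \<le> t < 2 T\<close>, so that some \<open>t\<close> in it satisfies
  \<open>(\<parallel>x (t + 1) - x t\<parallel> / \<mu> t)\<^sup>2 \<le> O(1 / (T \<mu> t)) = O(1 / sqrt T)\<close>, as does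
  \<open>\<parallel>c (x t) - y t\<parallel>\<^sup>2\<close>. Taking \<open>T\<close> of order \<open>\<epsilon>\<close> to the power \<open>-4\<close> yields the claim without any
  logarithmic factor, i.e. with \<open>\<kappa> = 0\<close>.
\<close>

section \<open>Subgradients from quadratic minorants\<close>

text \<open>Divided by the distance to \<open>a\<close>, the quadratic term tends to 0, so the
  difference quotients have nonnegative lower limit. Both \<open>Argmin\<close> conditions of the
  algorithm take this shape once their quadratics are expanded, which replaces a sum rule for
  nonconvex functions.\<close>

lemma regular_subdiff_quadratic_minorant:
  fixes \<phi> :: "'a::real_inner \<Rightarrow> ereal"
  assumes fin: "\<bar>\<phi> a\<bar> \<noteq> \<infinity>"
    and minorant: "\<And>u. \<phi> a + ereal (v \<bullet> (u - a) - K * (norm (u - a))\<^sup>2) \<le> \<phi> u"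
  shows "v \<in> regular_subdiff \<phi> a"
proof -
  obtain p where p: "\<phi> a = ereal p" using fin by auto
  have "((\<lambda>x. ereal (- (K * norm (x - a)))) \<longlongrightarrow> ereal (- (K * norm (a - a)))) (at a)"
    by (intro tendsto_intros)
  then have lim: "((\<lambda>x. ereal (- (K * norm (x - a)))) \<longlongrightarrow> 0) (at a)"
    by (simp add: zero_ereal_def)
  have "\<forall>\<^sub>F x in at a. ereal (- (K * norm (x - a)))
      \<le> (\<phi> x - \<phi> a - ereal (v \<bullet> (x - a))) / ereal (norm (x - a))"
    unfolding eventually_at_filter
  proof (intro always_eventually allI impI)
    fix x assume "x \<noteq> a"
    then have pos: "norm (x - a) > 0" by simp
    show "ereal (- (K * norm (x - a)))
      \<le> (\<phi> x - \<phi> a - ereal (v \<bullet> (x - a))) / ereal (norm (x - a))"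
    proof (cases "\<phi> x")
      case (real r)
      have "p + (v \<bullet> (x - a) - K * (norm (x - a))\<^sup>2) \<le> r"
        using minorant[of x] by (simp add: p real)
      then have "- (K * norm (x - a)) * norm (x - a) \<le> r - p - v \<bullet> (x - a)"
        by (simp add: power2_eq_square algebra_simps)
      then show ?thesis using pos by (simp add: p real pos_le_divide_eq)
    next
      case PInf
      then show ?thesis using pos by (simp add: p)
    next
      case MInf
      then show ?thesis using minorant[of x] by (simp add: p)
    qed
  qed
  then have "Liminf (at a) (\<lambda>x. ereal (- (K * norm (x - a))))
      \<le> Liminf (at a) (\<lambda>x. (\<phi> x - \<phi> a - ereal (v \<bullet> (x - a))) / ereal (norm (x - a)))"
    by (rule Liminf_mono)
  moreover have "0 \<le> Liminf (at a) (\<lambda>x. ereal (- (K * norm (x - a))))"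
  \<comment> \<open>A \<open>real_inner\<close> type may consist of a single point; the filter is
    then \<open>bot\<close>, and a limit no longer determines the \<open>Liminf\<close>.\<close>
  proof (cases "at a = bot")
    case False
    then show ?thesis using lim_imp_Liminf[OF False lim] by simp
  next
    case True
    then show ?thesis by (intro Liminf_bounded) simp
  qed
  ultimately show ?thesis
    by (auto simp: regular_subdiff_def edom_def p)
qed

lemma regular_subdiff_subset_limiting: "regular_subdiff \<phi> a \<subseteq> limiting_subdiff \<phi> a"
proof
  fix v assume v: "v \<in> regular_subdiff \<phi> a"
  then have "a \<in> edom \<phi>" by (simp add: regular_subdiff_def)
  with v show "v \<in> limiting_subdiff \<phi> a"
    unfolding limiting_subdiff_def mem_Collect_eq
    by (intro conjI exI[of _ "\<lambda>_. a"] exI[of _ "\<lambda>_. v"]) auto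
qed

section \<open>Gradients, Jacobians and linearization errors\<close>

text \<open>\<open>grad\<close> is a definite description, so existence and uniqueness are both
  required: the values of the derivative on \<open>Basis\<close> give a representing vector, and
  uniqueness of derivatives determines it.\<close>

lemma has_derivative_grad:
  fixes f :: "'a::euclidean_space \<Rightarrow> real"
  assumes "f differentiable (at x)"
  shows "(f has_derivative (\<lambda>d. grad f x \<bullet> d)) (at x)"
proof -
  obtain f' where f': "(f has_derivative f') (at x)"
    using assms by (auto simp: differentiable_def)
  define D where "D = (\<Sum>i\<in>Basis. f' i *\<^sub>R i)"
  interpret linear f' using f' has_derivative_linear by blast
  have "f' d = d \<bullet> D" for d
  proof -
    have "f' d = f' (\<Sum>i\<in>Basis. (d \<bullet> i) *\<^sub>R i)" by (simp add: euclidean_representation)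
    also have "\<dots> = d \<bullet> D" by (simp add: sum scale D_def inner_sum_right mult.commute)
    finally show ?thesis .
  qed
  then have "f' = (\<lambda>d. d \<bullet> D)" by blast
  then have D: "GDERIV f x :> D" using f' by (simp add: gderiv_def)
  have "grad f x = D" unfolding grad_def
  proof (rule the_equality)
    show "GDERIV f x :> D" by (rule D)
  next
    fix D' assume "GDERIV f x :> D'"
    then have "(\<lambda>d. d \<bullet> D') = (\<lambda>d. d \<bullet> D)"
      using D has_derivative_unique unfolding gderiv_def by blast
    then show "D' = D" by (simp only: fun_eq_iff vector_eq_ldot)
  qed
  then show ?thesis using D by (simp add: gderiv_def inner_commute)
qed

lemma norm_matrix_vector_le_opnorm: "norm (A *v v) \<le> opnorm A * norm v"
  unfolding opnorm_def by (rule onorm) (rule matrix_vector_mul_bounded_linear)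

text \<open>With \<open>u = transpose A *v w\<close>, the square of \<open>norm u\<close> equals
  \<open>w \<bullet> (A *v u)\<close>; after Cauchy-Schwarz one factor \<open>norm u\<close>
  cancels.\<close>

lemma norm_transpose_matrix_vector_le_opnorm:
  "norm (transpose A *v w) \<le> opnorm A * norm (w :: real^'m)"
proof (cases "transpose A *v w = 0")
  case True
  then show ?thesis
    unfolding opnorm_def by (simp add: onorm_pos_le)
next
  case False
  let ?u = "transpose A *v w"
  have "(norm ?u)\<^sup>2 = w \<bullet> (A *v ?u)"
    by (metis dot_lmul_matrix power2_norm_eq_inner transpose_matrix_vector)
  also have "\<dots> \<le> norm w * norm (A *v ?u)" by (rule norm_cauchy_schwarz)
  also have "\<dots> \<le> norm w * (opnorm A * norm ?u)"
    by (intro mult_left_mono norm_matrix_vector_le_opnorm) simp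
  finally have "norm ?u * norm ?u \<le> (opnorm A * norm w) * norm ?u"
    by (simp add: power2_eq_square ac_simps)
  then show ?thesis using False by (simp add: mult_right_le_imp_le)
qed

text \<open>On the segment the gradient varies by at most \<open>L * norm (u - x)\<close>, and the
  mean value inequality applies. Not integrating costs a factor: the constant is \<open>L\<close>
  instead of \<open>L / 2\<close>, which affects only the step-size threshold.\<close>

lemma smooth_upper_bound:
  fixes f :: "'a::euclidean_space \<Rightarrow> real"
  assumes diff: "\<And>x. f differentiable (at x)"
    and lip: "\<And>x z. norm (grad f x - grad f z) \<le> L * norm (x - z)" and "L \<ge> 0"
  shows "f u \<le> f x + grad f x \<bullet> (u - x) + L * (norm (u - x))\<^sup>2"
proof -
  have "norm (f u - f x - grad f x \<bullet> (u - x)) \<le> norm (u - x) * (L * norm (u - x))"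
  proof (rule differentiable_bound_linearization[where S = "closed_segment x u" and f = f
        and f' = "\<lambda>\<xi> d. grad f \<xi> \<bullet> d" and ?x0.0 = x])
    fix \<xi> assume \<xi>: "\<xi> \<in> closed_segment x u"
    have "onorm (\<lambda>d. grad f \<xi> \<bullet> d - grad f x \<bullet> d) \<le> L * norm (u - x)"
    proof (rule onorm_bound)
      fix d
      have "norm (grad f \<xi> \<bullet> d - grad f x \<bullet> d) \<le> norm (grad f \<xi> - grad f x) * norm d"
        by (metis Cauchy_Schwarz_ineq2 inner_diff_left real_norm_def)
      also have "\<dots> \<le> L * norm (\<xi> - x) * norm d"
        using lip by (intro mult_right_mono) auto
      also have "\<dots> \<le> L * norm (u - x) * norm d"
        using segment_bound1[OF \<xi>] \<open>L \<ge> 0\<close> by (intro mult_right_mono mult_left_mono) auto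
      finally show "norm (grad f \<xi> \<bullet> d - grad f x \<bullet> d) \<le> L * norm (u - x) * norm d" .
    qed (use \<open>L \<ge> 0\<close> in auto)
    then show "onorm ((\<lambda>d. grad f \<xi> \<bullet> d) - (\<lambda>d. grad f x \<bullet> d)) \<le> L * norm (u - x)"
      by (simp add: fun_diff_def)
  next
    show "x + t *\<^sub>R (u - x) \<in> closed_segment x u" if "t \<in> {0..1}" for t :: real
      unfolding in_segment using that by (auto intro!: exI[of _ t] simp: algebra_simps)
  qed (auto intro: has_derivative_at_withinI has_derivative_grad diff)
  moreover have "norm (u - x) * (L * norm (u - x)) = L * (norm (u - x))\<^sup>2"
    by (simp add: power2_eq_square)
  ultimately show ?thesis by (simp only: real_norm_def abs_le_iff) linarith
qed

text \<open>The argument of \<open>smooth_upper_bound\<close> for vector values, relative to a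
  convex set because the Jacobian is known to be Lipschitz only on the closed convex hull of the
  domain of \<open>g\<close>.\<close>

lemma norm_linearization_error_le:
  fixes c :: "real^'n \<Rightarrow> real^'m"
  assumes diff: "\<And>x. c differentiable (at x)"
    and "convex S" "x \<in> S" "u \<in> S"
    and lip: "\<And>x z. x \<in> S \<Longrightarrow> z \<in> S \<Longrightarrow> opnorm (Jac c x - Jac c z) \<le> L * norm (x - z)"
    and "L \<ge> 0"
  shows "norm (c u - c x - Jac c x *v (u - x)) \<le> L * (norm (u - x))\<^sup>2"
proof -
  have seg: "closed_segment x u \<subseteq> S"
    using assms by (intro closed_segment_subset)
  have "norm (c u - c x - Jac c x *v (u - x)) \<le> norm (u - x) * (L * norm (u - x))"
  proof (rule differentiable_bound_linearization[where S = "closed_segment x u" and f = c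
        and f' = "\<lambda>\<xi> d. Jac c \<xi> *v d" and ?x0.0 = x])
    fix \<xi> assume \<xi>: "\<xi> \<in> closed_segment x u"
    have "onorm ((\<lambda>d. Jac c \<xi> *v d) - (\<lambda>d. Jac c x *v d)) = opnorm (Jac c \<xi> - Jac c x)"
      by (simp add: opnorm_def matrix_vector_mult_diff_rdistrib fun_diff_def)
    also have "\<dots> \<le> L * norm (\<xi> - x)"
      using lip \<xi> seg \<open>x \<in> S\<close> by blast
    also have "\<dots> \<le> L * norm (u - x)"
      using segment_bound1[OF \<xi>] \<open>L \<ge> 0\<close> by (intro mult_left_mono)
    finally show "onorm ((\<lambda>d. Jac c \<xi> *v d) - (\<lambda>d. Jac c x *v d)) \<le> L * norm (u - x)" .
  next
    show "(c has_derivative (\<lambda>d. Jac c \<xi> *v d)) (at \<xi> within closed_segment x u)" for \<xi>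
      using diff jacobian_works has_derivative_at_withinI by blast
  next
    show "x + t *\<^sub>R (u - x) \<in> closed_segment x u" if "t \<in> {0..1}" for t :: real
      unfolding in_segment using that by (auto intro!: exI[of _ t] simp: algebra_simps)
  qed auto
  moreover have "norm (u - x) * (L * norm (u - x)) = L * (norm (u - x))\<^sup>2"
    by (simp add: power2_eq_square)
  ultimately show ?thesis by (simp only:)
qed

lemma norm_diff_le_of_opnorm_le:
  fixes c :: "real^'n \<Rightarrow> real^'m"
  assumes diff: "\<And>x. c differentiable (at x)"
    and "convex S" "x \<in> S" "u \<in> S"
    and bound: "\<And>x. x \<in> S \<Longrightarrow> opnorm (Jac c x) \<le> M"
  shows "norm (c u - c x) \<le> M * norm (u - x)"
proof (rule differentiable_bound[OF \<open>convex S\<close> _ _ \<open>u \<in> S\<close> \<open>x \<in> S\<close>])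
  show "(c has_derivative (\<lambda>d. Jac c \<xi> *v d)) (at \<xi> within S)" for \<xi>
    using diff jacobian_works has_derivative_at_withinI by blast
  show "onorm (\<lambda>d. Jac c \<xi> *v d) \<le> M" if "\<xi> \<in> S" for \<xi>
    using bound[OF that] by (simp add: opnorm_def)
qed

section \<open>Optimality of the subproblem and of the proximal step\<close>

lemma proper_edom_finite: "proper \<phi> \<Longrightarrow> x \<in> edom \<phi> \<Longrightarrow> \<bar>\<phi> x\<bar> \<noteq> \<infinity>"
  by (auto simp: proper_def edom_def)

lemma proper_edom_real: "proper \<phi> \<Longrightarrow> x \<in> edom \<phi> \<Longrightarrow> \<phi> x = ereal (real_of_ereal (\<phi> x))"
  using proper_edom_finite by (metis ereal_real')

lemma Argmin_subproblem_edom: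
  assumes "proper g" "x \<in> edom g" "u \<in> Argmin (subproblem f g c b x y \<mu>)"
  shows "u \<in> edom g"
proof -
  have "subproblem f g c b x y \<mu> u \<le> subproblem f g c b x y \<mu> x"
    using assms(3) by (simp add: Argmin_def)
  then show ?thesis using assms(1,2)
    by (cases "g u"; cases "g x") (auto simp: subproblem_def edom_def proper_def)
qed

lemma Argmin_subproblem_le:
  assumes "proper g" "u \<in> edom g" "v \<in> edom g" "u \<in> Argmin (subproblem f g c b x y \<mu>)"
  defines "D \<equiv> grad f x + b *\<^sub>R (transpose (Jac c x) *v (c x - y))"
  shows "D \<bullet> u + 1 / \<mu> * (norm (u - x))\<^sup>2 + real_of_ereal (g u)
    \<le> D \<bullet> v + 1 / \<mu> * (norm (v - x))\<^sup>2 + real_of_ereal (g v)"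
proof -
  have "subproblem f g c b x y \<mu> u \<le> subproblem f g c b x y \<mu> v"
    using assms(4) by (simp add: Argmin_def)
  then show ?thesis
    unfolding subproblem_def D_def
    by (subst (asm) (1 2) proper_edom_real[OF assms(1)]) (use assms in auto)
qed

lemma norm_diff_square_expand:
  fixes u v x :: "'a::real_inner"
  shows "(norm (v - x))\<^sup>2 = (norm (u - x))\<^sup>2 + 2 * ((u - x) \<bullet> (v - u)) + (norm (v - u))\<^sup>2"
proof -
  have "(norm (a + b))\<^sup>2 = (norm a)\<^sup>2 + 2 * (a \<bullet> b) + (norm b)\<^sup>2" for a b :: 'a
    by (simp add: power2_norm_eq_inner inner_add_left inner_add_right inner_commute[of b a])
  from this[of "u - x" "v - u"] show ?thesis by simp
qed

text \<open>Expanding \<open>(norm (v - x))\<^sup>2\<close> around \<open>u\<close> turns minimality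
  into a quadratic minorant of \<open>g\<close> at \<open>u\<close> with curvature
  \<open>1 / \<mu>\<close>. The factor 2 arises since the subproblem weights the square by
  \<open>1 / \<mu>\<close>, not by \<open>1 / (2 * \<mu>)\<close>.\<close>

lemma Argmin_subproblem_subdiff:
  assumes "proper g" "x \<in> edom g" "u \<in> Argmin (subproblem f g c b x y \<mu>)"
  shows "- (grad f x + b *\<^sub>R (transpose (Jac c x) *v (c x - y))) - (2 / \<mu>) *\<^sub>R (u - x)
    \<in> limiting_subdiff g u"
proof -
  let ?D = "grad f x + b *\<^sub>R (transpose (Jac c x) *v (c x - y))"
  have u: "u \<in> edom g" using Argmin_subproblem_edom assms by blast
  have "g u + ereal ((- ?D - (2 / \<mu>) *\<^sub>R (u - x)) \<bullet> (v - u) - 1 / \<mu> * (norm (v - u))\<^sup>2) \<le> g v" for v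
  proof (cases "v \<in> edom g")
    case True
    have "?D \<bullet> u + 1 / \<mu> * (norm (u - x))\<^sup>2 + real_of_ereal (g u)
        \<le> ?D \<bullet> v + 1 / \<mu> * (norm (v - x))\<^sup>2 + real_of_ereal (g v)"
      by (rule Argmin_subproblem_le) (use assms u True in auto)
    then have "real_of_ereal (g u)
        + ((- ?D - (2 / \<mu>) *\<^sub>R (u - x)) \<bullet> (v - u) - 1 / \<mu> * (norm (v - u))\<^sup>2)
        \<le> real_of_ereal (g v)"
      unfolding norm_diff_square_expand[of v x u]
      by (simp add: inner_diff_left inner_diff_right inner_add_left distrib_left ring_distribs)
    then show ?thesis
      by (subst (1 2) proper_edom_real[OF \<open>proper g\<close>]) (use u True in auto)
  next
    case False
    then show ?thesis by (simp add: edom_def)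
  qed
  then show ?thesis
    by (intro subsetD[OF regular_subdiff_subset_limiting]
        regular_subdiff_quadratic_minorant[where K = "1 / \<mu>"] proper_edom_finite \<open>proper g\<close> u)
qed

lemma accepted_iff:
  assumes "proper g" "x \<in> edom g" "u \<in> edom g"
  shows "accepted f g c b x y \<mu> u \<longleftrightarrow>
    norm (c u - c x) \<le> sqrt (1 / (\<mu> * b)) * norm (u - x) \<and>
    f u + real_of_ereal (g u) + b / 2 * (norm (c u - y))\<^sup>2
      \<le> f x + real_of_ereal (g x) + b / 2 * (norm (c x - y))\<^sup>2 - 1 / (2 * \<mu>) * (norm (u - x))\<^sup>2"
  unfolding accepted_def
  by (subst (1 2) proper_edom_real[OF assms(1)]) (use assms in auto)

lemma Prox_le:
  assumes "proper h" "edom h = UNIV" "y \<in> Prox (1 / b) h a" "b > 0"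
  shows "b / 2 * (norm (a - y))\<^sup>2 + real_of_ereal (h y) \<le> b / 2 * (norm (a - v))\<^sup>2 + real_of_ereal (h v)"
proof -
  have "ereal (b / 2 * (norm (a - y))\<^sup>2) + h y \<le> ereal (b / 2 * (norm (a - v))\<^sup>2) + h v"
    using assms(3) by (simp add: Prox_def Argmin_def)
  then show ?thesis
    by (subst (asm) (1 2) proper_edom_real[OF assms(1)]) (use assms in auto)
qed

text \<open>The same expansion with curvature \<open>b / 2\<close>. The scaled residual becomes the
  multiplier for \<open>h\<close> in the stationarity condition.\<close>

lemma Prox_subdiff:
  assumes "proper h" "edom h = UNIV" "y \<in> Prox (1 / b) h a" "b > 0"
  shows "b *\<^sub>R (a - y) \<in> limiting_subdiff h y"
proof -
  have "h y + ereal ((b *\<^sub>R (a - y)) \<bullet> (v - y) - b / 2 * (norm (v - y))\<^sup>2) \<le> h v" for v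
  proof -
    have "b / 2 * (norm (y - a))\<^sup>2 + real_of_ereal (h y)
        \<le> b / 2 * (norm (v - a))\<^sup>2 + real_of_ereal (h v)"
      using Prox_le[OF assms, of v] by (simp only: norm_minus_commute)
    then have "real_of_ereal (h y) + ((b *\<^sub>R (a - y)) \<bullet> (v - y) - b / 2 * (norm (v - y))\<^sup>2)
        \<le> real_of_ereal (h v)"
      unfolding norm_diff_square_expand[of v a y]
      by (simp add: inner_diff_left inner_diff_right ring_distribs)
    then show ?thesis
      by (subst (1 2) proper_edom_real[OF \<open>proper h\<close>]) (use assms in auto)
  qed
  then show ?thesis
    by (intro subsetD[OF regular_subdiff_subset_limiting]
        regular_subdiff_quadratic_minorant[where K = "b / 2"] proper_edom_finite \<open>proper h\<close>)
      (use assms(2) in auto)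
qed

section \<open>Step sizes accepted by the search\<close>

lemma search_success:
  assumes "search f g c b \<rho> x y \<mu> u \<mu>'"
  shows "u \<in> Argmin (subproblem f g c b x y \<mu>')" "accepted f g c b x y \<mu>' u"
  using assms by (induction) auto

lemma search_step_size_le:
  assumes "search f g c b \<rho> x y \<mu> u \<mu>'" "0 < \<rho>" "\<rho> < 1" "0 < \<mu>"
  shows "0 < \<mu>' \<and> \<mu>' \<le> \<mu>"
  using assms
proof (induction)
  case (failure v \<mu> u \<mu>')
  then have "\<rho> * \<mu> \<le> \<mu>" by simp
  with failure show ?case by force
qed auto

text \<open>A rejected step size exceeds \<tau>, so its reduction still exceeds
  \<open>\<rho> * \<tau>\<close>: backtracking undershoots the threshold by at most the factor
  \<rho>. The minimum covers acceptance at the first trial.\<close>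

lemma search_step_size_ge:
  assumes "search f g c b \<rho> x y \<mu> u \<mu>'" "0 < \<rho>" "\<rho> < 1" "0 < \<mu>"
    and "\<And>v \<mu>. v \<in> Argmin (subproblem f g c b x y \<mu>) \<Longrightarrow> 0 < \<mu> \<Longrightarrow> \<mu> \<le> \<tau>
      \<Longrightarrow> accepted f g c b x y \<mu> v"
  shows "min \<mu> (\<rho> * \<tau>) \<le> \<mu>'"
  using assms
proof (induction)
  case (failure v \<mu> u \<mu>')
  then have "\<tau> < \<mu>" by (meson not_le)
  then have "\<rho> * \<tau> \<le> \<rho> * \<mu>" using \<open>0 < \<rho>\<close> by simp
  moreover have "min (\<rho> * \<mu>) (\<rho> * \<tau>) \<le> \<mu>'" using failure by simp
  ultimately show ?case by linarith
qed auto

text \<open>The first-order terms of \<open>f\<close> and of the penalty are those of the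
  subproblem. Its minimality yields a gain of \<open>1 / \<mu>\<close> times the squared step; half
  of it pays for the second-order errors bounded through \<open>small\<close>, the other half is the
  required decrease.\<close>

lemma accepted_if_step_size_small:
  fixes f :: "real^'n \<Rightarrow> real" and c :: "real^'n \<Rightarrow> real^'m"
  assumes "proper g" "x \<in> edom g" "u \<in> Argmin (subproblem f g c b x y \<mu>)" "0 < \<mu>" "0 < b"
    and f_diff: "\<And>x. f differentiable (at x)"
    and f_lip: "\<And>x z. norm (grad f x - grad f z) \<le> L * norm (x - z)" and "0 \<le> L"
    and c_diff: "\<And>x. c differentiable (at x)"
    and "convex S" "edom g \<subseteq> S"
    and c_lip: "\<And>x z. x \<in> S \<Longrightarrow> z \<in> S \<Longrightarrow> opnorm (Jac c x - Jac c z) \<le> L\<^sub>c * norm (x - z)"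
    and c_bound: "\<And>x. x \<in> S \<Longrightarrow> opnorm (Jac c x) \<le> M" and "0 \<le> L\<^sub>c" "0 < M"
    and "norm (c x - y) \<le> B"
    and small: "\<mu> * (2 * L + b * (M\<^sup>2 + 2 * B * L\<^sub>c)) \<le> 1"
  shows "accepted f g c b x y \<mu> u"
proof -
  have u: "u \<in> edom g" using Argmin_subproblem_edom assms by blast
  have S: "x \<in> S" "u \<in> S" using u assms by auto
  have "0 \<le> B" using \<open>norm (c x - y) \<le> B\<close> norm_ge_zero order_trans by blast
  define n where "n = norm (u - x)"
  define r where "r = c u - c x - Jac c x *v (u - x)"
  define p where "p = c x - y"
  have c: "norm (c u - c x) \<le> M * n"
    unfolding n_def by (rule norm_diff_le_of_opnorm_le[where S = S]) (use assms S in auto)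
  have r: "norm r \<le> L\<^sub>c * n\<^sup>2"
    unfolding n_def r_def by (rule norm_linearization_error_le[where S = S]) (use assms S in auto)
  \<comment> \<open>Test (a) follows from \<open>small\<close> by dropping nonnegative
    summands.\<close>
  have "\<mu> * b * M\<^sup>2 \<le> \<mu> * (2 * L + b * (M\<^sup>2 + 2 * B * L\<^sub>c))"
    using assms \<open>0 \<le> B\<close> by (simp add: algebra_simps)
  then have "\<mu> * b * M\<^sup>2 \<le> 1" using small by linarith
  then have "M\<^sup>2 \<le> 1 / (\<mu> * b)"
    using assms by (simp add: pos_le_divide_eq ac_simps)
  then have "M \<le> sqrt (1 / (\<mu> * b))"
    by (rule real_le_rsqrt)
  then have 1: "norm (c u - c x) \<le> sqrt (1 / (\<mu> * b)) * norm (u - x)"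
    using c unfolding n_def by (meson mult_right_mono norm_ge_zero order_trans)
  have f: "f u \<le> f x + grad f x \<bullet> (u - x) + L * n\<^sup>2"
    unfolding n_def using smooth_upper_bound f_diff f_lip \<open>0 \<le> L\<close> by blast
  have "(norm (c u - y))\<^sup>2 = (norm p)\<^sup>2 + 2 * (p \<bullet> (c u - c x)) + (norm (c u - c x))\<^sup>2"
    unfolding p_def by (rule norm_diff_square_expand)
  also have "p \<bullet> (c u - c x) = p \<bullet> (Jac c x *v (u - x)) + p \<bullet> r"
    by (simp add: r_def inner_diff_right)
  also have "p \<bullet> (Jac c x *v (u - x)) = (transpose (Jac c x) *v p) \<bullet> (u - x)"
    by (metis dot_lmul_matrix transpose_matrix_vector)
  also have "p \<bullet> r \<le> B * (L\<^sub>c * n\<^sup>2)"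
  proof -
    have "p \<bullet> r \<le> norm p * norm r" by (rule norm_cauchy_schwarz)
    also have "\<dots> \<le> B * (L\<^sub>c * n\<^sup>2)"
      using assms r \<open>0 \<le> B\<close> by (intro mult_mono) (auto simp: p_def)
    finally show ?thesis .
  qed
  also have "(norm (c u - c x))\<^sup>2 \<le> (M * n)\<^sup>2"
    using c by (intro power_mono) auto
  finally have "(norm (c u - y))\<^sup>2 \<le> (norm p)\<^sup>2 + 2 * ((transpose (Jac c x) *v p) \<bullet> (u - x))
      + (M\<^sup>2 + 2 * B * L\<^sub>c) * n\<^sup>2"
    by (simp add: algebra_simps power_mult_distrib)
  then have "b / 2 * (norm (c u - y))\<^sup>2 \<le> b / 2 * ((norm p)\<^sup>2
      + 2 * ((transpose (Jac c x) *v p) \<bullet> (u - x)) + (M\<^sup>2 + 2 * B * L\<^sub>c) * n\<^sup>2)"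
    using \<open>0 < b\<close> by (intro mult_left_mono) auto
  then have q: "b / 2 * (norm (c u - y))\<^sup>2 \<le> b / 2 * (norm p)\<^sup>2
      + b * ((transpose (Jac c x) *v p) \<bullet> (u - x)) + b / 2 * (M\<^sup>2 + 2 * B * L\<^sub>c) * n\<^sup>2"
    by (simp add: algebra_simps)
  \<comment> \<open>Comparison with the current iterate, whose proximal term vanishes.\<close>
  have g: "(grad f x + b *\<^sub>R (transpose (Jac c x) *v p)) \<bullet> u + 1 / \<mu> * n\<^sup>2 + real_of_ereal (g u)
     \<le> (grad f x + b *\<^sub>R (transpose (Jac c x) *v p)) \<bullet> x + 1 / \<mu> * (norm (x - x))\<^sup>2
       + real_of_ereal (g x)"
    unfolding n_def p_def by (rule Argmin_subproblem_le) (use assms u in auto)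
  have "(2 * L + b * (M\<^sup>2 + 2 * B * L\<^sub>c)) \<le> 1 / \<mu>"
    using small \<open>0 < \<mu>\<close> by (simp add: pos_le_divide_eq ac_simps)
  then have "(2 * L + b * (M\<^sup>2 + 2 * B * L\<^sub>c)) * n\<^sup>2 \<le> 1 / \<mu> * n\<^sup>2"
    by (intro mult_right_mono) auto
  then have "L * n\<^sup>2 + b / 2 * (M\<^sup>2 + 2 * B * L\<^sub>c) * n\<^sup>2 \<le> 1 / (2 * \<mu>) * n\<^sup>2"
    by (simp add: algebra_simps)
  moreover have "1 / \<mu> * n\<^sup>2 = 1 / (2 * \<mu>) * n\<^sup>2 + 1 / (2 * \<mu>) * n\<^sup>2"
    by simp
  ultimately have "f u + real_of_ereal (g u) + b / 2 * (norm (c u - y))\<^sup>2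
      \<le> f x + real_of_ereal (g x) + b / 2 * (norm p)\<^sup>2 - 1 / (2 * \<mu>) * n\<^sup>2"
    using f q g by (simp only: inner_diff_right inner_add_left inner_scaleR_left
        right_diff_distrib diff_self norm_zero) simp
  then show ?thesis
    unfolding accepted_iff[OF \<open>proper g\<close> \<open>x \<in> edom g\<close> u] n_def p_def using 1 by blast
qed

section \<open>A pigeonhole argument over a dyadic window\<close>

text \<open>The perturbations over the window sum to at most \<open>T * (E / T) = E\<close>. If
  every \<open>a t\<close> exceeded the bound, telescoping would make \<phi> fall by more than
  \<open>hi - lo\<close>.\<close>

lemma exists_small_term_in_window:
  fixes \<phi> a :: "nat \<Rightarrow> real"
  assumes step: "\<And>t. \<phi> (Suc t) \<le> \<phi> t - a t + E / (real t + 1)"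
    and lower: "\<And>t. lo \<le> \<phi> (Suc t)" and upper: "\<And>t. \<phi> (Suc t) \<le> hi"
    and "0 \<le> E" "1 \<le> T"
  shows "\<exists>t\<in>{T..<2 * T}. a t \<le> (hi - lo + E) / real T"
proof (rule ccontr)
  assume "\<not> ?thesis"
  then have large: "(hi - lo + E) / real T < a t" if "t \<in> {T..<2 * T}" for t
    using that by force
  have pos: "0 < real T" using \<open>1 \<le> T\<close> by simp
  have "\<phi> (2 * T) - \<phi> T = (\<Sum>t = T..<2 * T. \<phi> (Suc t) - \<phi> t)"
    by (rule sum_Suc_diff'[symmetric]) simp
  also have "\<dots> < (\<Sum>t = T..<2 * T. E / real T - (hi - lo + E) / real T)"
  proof (rule sum_strict_mono)
    fix t assume t: "t \<in> {T..<2 * T}"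
    have "E / (real t + 1) \<le> E / real T"
      using t pos \<open>0 \<le> E\<close> by (intro divide_left_mono) auto
    then show "\<phi> (Suc t) - \<phi> t < E / real T - (hi - lo + E) / real T"
      using step[of t] large[OF t] by linarith
  qed (use \<open>1 \<le> T\<close> in auto)
  also have "\<dots> = lo - hi"
    using pos by (simp add: field_simps)
  finally show False
    \<comment> \<open>The bounds hold at successor indices only; \<open>1 \<le> T\<close> makes
      \<open>T\<close> and \<open>2 * T\<close> successors.\<close>
    using lower[of "2 * T - 1"] upper[of "T - 1"] \<open>1 \<le> T\<close> by simp
qed

section \<open>Residual and step-size bounds along a run\<close>

text \<open>Fixing \<open>L\<close>, \<open>L\<^sub>c\<close> and \<open>M\<close> turns the
  existential constants of the standing assumption into parameters shared by all bounds
  below.\<close>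

locale sdcam_run =
  fixes f :: "real^'n \<Rightarrow> real" and g :: "real^'n \<Rightarrow> ereal"
    and h :: "real^'m \<Rightarrow> ereal" and c :: "real^'n \<Rightarrow> real^'m"
    and \<mu>\<^sub>m\<^sub>a\<^sub>x \<mu>\<^sub>0 \<rho> \<eta> \<alpha>\<^sub>0 \<gamma>\<^sub>0 \<eta>\<^sub>0 L L\<^sub>c M :: real and \<beta> \<mu> :: "nat \<Rightarrow> real"
    and x :: "nat \<Rightarrow> real^'n" and y :: "nat \<Rightarrow> real^'m"
  assumes standing: "standing_assumption f g h c"
    and dom_h: "edom h = UNIV"
    and compact_dom_g: "compact (edom g)"
    and parameters: "sdcam_parameters \<mu>\<^sub>m\<^sub>a\<^sub>x \<mu>\<^sub>0 \<rho> \<eta> \<beta>"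
    and growth: "growth_condition (1 / 2) \<alpha>\<^sub>0 \<gamma>\<^sub>0 \<eta>\<^sub>0 \<beta>"
    and generated: "sdcam_generated f g h c \<mu>\<^sub>m\<^sub>a\<^sub>x \<mu>\<^sub>0 \<rho> \<eta> \<beta> x y \<mu>"
    and L_pos: "0 < L" and L\<^sub>c_pos: "0 < L\<^sub>c" and M_pos: "0 < M"
    and grad_lip: "\<And>x z. norm (grad f x - grad f z) \<le> L * norm (x - z)"
    and Jac_lip: "\<And>x z. x \<in> closure (convex hull (edom g)) \<Longrightarrow> z \<in> closure (convex hull (edom g))
      \<Longrightarrow> opnorm (Jac c x - Jac c z) \<le> L\<^sub>c * norm (x - z)"
    and Jac_bound: "\<And>x. x \<in> closure (convex hull (edom g)) \<Longrightarrow> opnorm (Jac c x) \<le> M"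
begin

abbreviation dom_hull :: "(real^'n) set" where "dom_hull \<equiv> closure (convex hull (edom g))"

lemma dom_subset_hull: "edom g \<subseteq> dom_hull"
  by (meson closure_subset hull_subset order_trans)

lemma convex_dom_hull: "convex dom_hull"
  by (intro convex_closure convex_convex_hull)

lemma proper_g: "proper g" and proper_h: "proper h"
  and f_diff: "f differentiable (at z)" and c_diff: "c differentiable (at z)"
  and continuous_g: "continuous_on (edom g) g" and continuous_h: "continuous_on UNIV h"
  using standing dom_h by (auto simp: standing_assumption_def)

lemma h_nonneg: "0 \<le> real_of_ereal (h z)"
proof -
  have "0 \<le> (INF y. h y)" using standing by (simp add: standing_assumption_def)
  then have "0 \<le> h z" by (meson INF_lower UNIV_I order_trans)
  then show ?thesis by (rule real_of_ereal_pos)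
qed

lemma param: "\<mu>\<^sub>0 < \<mu>\<^sub>m\<^sub>a\<^sub>x" "0 < \<mu>\<^sub>0" "0 < \<rho>" "\<rho> < 1" "1 \<le> \<eta>"
  and \<beta>_pos: "0 < \<beta> t" and \<beta>_mono: "incseq \<beta>"
  using parameters by (auto simp: sdcam_parameters_def)

lemma growth_pos: "0 < \<alpha>\<^sub>0" "0 < \<gamma>\<^sub>0" "0 < \<eta>\<^sub>0"
  using growth by (auto simp: growth_condition_def)

lemma \<beta>_ge: "\<alpha>\<^sub>0 * sqrt (real t + 1) \<le> \<beta> t" and \<beta>_le: "\<beta> t \<le> \<gamma>\<^sub>0 * sqrt (real t + 1)"
proof -
  have "\<alpha>\<^sub>0 * real (t + 1) powr (1 / 2) \<le> \<beta> t \<and> \<beta> t \<le> \<gamma>\<^sub>0 * real (t + 1) powr (1 / 2)"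
    using growth unfolding growth_condition_def by blast
  then show "\<alpha>\<^sub>0 * sqrt (real t + 1) \<le> \<beta> t" "\<beta> t \<le> \<gamma>\<^sub>0 * sqrt (real t + 1)"
    by (simp_all add: powr_half_sqrt add.commute)
qed

lemma \<beta>_increment_nonneg: "0 \<le> \<beta> (Suc t) - \<beta> t"
  using \<beta>_mono by (simp add: incseq_SucD)

lemma \<beta>_increment_le: "\<beta> (Suc t) - \<beta> t \<le> \<eta>\<^sub>0 / sqrt (real t + 1)"
proof -
  have "1 \<le> Suc t \<longrightarrow> \<beta> (Suc t) - \<beta> (Suc t - 1) \<le> \<eta>\<^sub>0 * real (Suc t) powr (1 / 2 - 1)"
    using growth unfolding growth_condition_def by blast
  moreover have "real (Suc t) powr (1 / 2 - 1) = 1 / sqrt (real t + 1)"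
    using powr_minus_divide[of "real (Suc t)" "1 / 2"] by (simp add: powr_half_sqrt add.commute)
  ultimately show ?thesis by simp
qed

text \<open>The proximal step controls the residual at \<open>Suc t\<close> with weight
  \<open>\<beta> t\<close>, whereas the potential there carries \<open>\<beta> (Suc t)\<close>; this
  ratio bound, from \<open>t + 2 \<le> 4 * (t + 1)\<close>, bridges the two.\<close>

lemma \<beta>_Suc_le: "\<beta> (Suc t) \<le> 2 * \<gamma>\<^sub>0 / \<alpha>\<^sub>0 * \<beta> t"
proof -
  have "sqrt (real (Suc t) + 1) \<le> sqrt (2\<^sup>2 * (real t + 1))"
    by (intro real_sqrt_le_mono) simp
  also have "\<dots> = 2 * sqrt (real t + 1)"
    by (simp only: real_sqrt_mult) simp
  finally have "sqrt (real (Suc t) + 1) \<le> 2 * sqrt (real t + 1)" .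
  moreover have "sqrt (real t + 1) \<le> \<beta> t / \<alpha>\<^sub>0"
    using \<beta>_ge[of t] growth_pos by (simp add: pos_le_divide_eq mult.commute)
  ultimately have "sqrt (real (Suc t) + 1) \<le> 2 * (\<beta> t / \<alpha>\<^sub>0)"
    by linarith
  then have "\<gamma>\<^sub>0 * sqrt (real (Suc t) + 1) \<le> \<gamma>\<^sub>0 * (2 * (\<beta> t / \<alpha>\<^sub>0))"
    using growth_pos by (intro mult_left_mono) auto
  with \<beta>_le[of "Suc t"] show ?thesis by (simp add: mult.commute mult.left_commute)
qed

text \<open>The step size at which search \<open>t\<close> starts; the case split absorbs the
  special initial value, so that \<open>search_step\<close> treats all indices alike.\<close>

definition trial :: "nat \<Rightarrow> real" where
  "trial t = (case t of 0 \<Rightarrow> \<mu>\<^sub>0 | Suc s \<Rightarrow> min \<mu>\<^sub>m\<^sub>a\<^sub>x (\<eta> * \<mu> s))"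

lemma search_step: "search f g c (\<beta> t) \<rho> (x t) (y t) (trial t) (x (Suc t)) (\<mu> t)"
  using generated by (cases t) (auto simp: sdcam_generated_def trial_def)

lemma prox_step: "y (Suc t) \<in> Prox (1 / \<beta> t) h (c (x (Suc t)))"
  using generated by (auto simp: sdcam_generated_def)

lemma iterate_in_dom: "x t \<in> edom g"
proof (induction t)
  case 0
  then show ?case using generated by (simp add: sdcam_generated_def)
next
  case (Suc t)
  then show ?case
    using Argmin_subproblem_edom[OF proper_g Suc] search_success(1)[OF search_step] by blast
qed

lemma trial_step_size_bounds: "0 < trial t \<and> trial t \<le> \<mu>\<^sub>m\<^sub>a\<^sub>x"
proof (induction t)
  case 0
  then show ?case using param by (simp add: trial_def)
next
  case (Suc t)
  then have "0 < \<mu> t" using search_step_size_le[OF search_step] param by blast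
  then show ?case using param by (simp add: trial_def)
qed

lemma step_size_pos: "0 < \<mu> t" and step_size_le: "\<mu> t \<le> \<mu>\<^sub>m\<^sub>a\<^sub>x"
  using search_step_size_le[OF search_step[of t]] param trial_step_size_bounds[of t] by auto

lemma trial_Suc_ge: "\<mu> t \<le> trial (Suc t)"
proof -
  have "1 * \<mu> t \<le> \<eta> * \<mu> t"
    using param step_size_pos by (intro mult_right_mono) (auto simp: less_imp_le)
  then show ?thesis using step_size_le by (simp add: trial_def)
qed

text \<open>Comparing the proximal point with \<open>c (x (Suc t))\<close> itself leaves only the
  value of \<open>h\<close> there, and \<open>h\<close> composed with \<open>c\<close> attains a
  maximum on the compact domain of \<open>g\<close>. Adding 1 to that maximum makes \<open>H\<close>
  positive.\<close>

lemma residual_bounded: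
  obtains H where "0 < H"
    and "\<And>t. \<beta> t / 2 * (norm (c (x (Suc t)) - y (Suc t)))\<^sup>2 + real_of_ereal (h (y (Suc t))) \<le> H"
proof -
  have "continuous_on UNIV c"
    by (simp add: c_diff continuous_at_imp_continuous_on differentiable_imp_continuous_within)
  then have "continuous_on (edom g) (\<lambda>z. h (c z))"
    by (intro continuous_on_compose2[OF continuous_h]) (auto intro: continuous_on_subset)
  moreover have "edom g \<noteq> {}" using iterate_in_dom by blast
  ultimately obtain z where z: "\<And>z'. z' \<in> edom g \<Longrightarrow> h (c z') \<le> h (c z)"
    using continuous_attains_sup[OF compact_dom_g] by metis
  have h: "h v = ereal (real_of_ereal (h v))" for v
    using proper_edom_real[OF proper_h] dom_h by blast
  have "\<beta> t / 2 * (norm (c (x (Suc t)) - y (Suc t)))\<^sup>2 + real_of_ereal (h (y (Suc t)))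
      \<le> real_of_ereal (h (c z)) + 1" for t
  proof -
    have "\<beta> t / 2 * (norm (c (x (Suc t)) - y (Suc t)))\<^sup>2 + real_of_ereal (h (y (Suc t)))
        \<le> real_of_ereal (h (c (x (Suc t))))"
      using Prox_le[OF proper_h dom_h prox_step \<beta>_pos, of t "c (x (Suc t))"] by simp
    moreover have "real_of_ereal (h (c (x (Suc t)))) \<le> real_of_ereal (h (c z))"
      using z[OF iterate_in_dom] h by (metis ereal_less_eq(3))
    ultimately show ?thesis by linarith
  qed
  moreover have "0 < real_of_ereal (h (c z)) + 1" using h_nonneg[of "c z"] by linarith
  ultimately show thesis using that by blast
qed

lemma step_size_lower_bound:
  obtains k where "0 < k" and "\<And>t. k / \<beta> t \<le> \<mu> t"
proof -
  obtain H where "0 < H"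
    and H: "\<And>t. \<beta> t / 2 * (norm (c (x (Suc t)) - y (Suc t)))\<^sup>2 + real_of_ereal (h (y (Suc t))) \<le> H"
    using residual_bounded by metis
  \<comment> \<open>The first summand serves \<open>t = 0\<close>, where \<open>y 0\<close> is
    arbitrary; the second serves later indices through
    \<open>\<beta> 0 \<le> \<beta> s\<close>.\<close>
  define B where "B = norm (c (x 0) - y 0) + sqrt (2 * H / \<beta> 0)"
  have B: "norm (c (x t) - y t) \<le> B" for t
  proof (cases t)
    case 0
    then show ?thesis using \<open>0 < H\<close> \<beta>_pos[of 0] by (simp add: B_def)
  next
    case (Suc s)
    have "\<beta> 0 / 2 * (norm (c (x t) - y t))\<^sup>2 \<le> \<beta> s / 2 * (norm (c (x t) - y t))\<^sup>2"
      using \<beta>_mono by (intro mult_right_mono divide_right_mono) (auto simp: incseq_def)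
    also have "\<dots> \<le> H" using H[of s] h_nonneg[of "y (Suc s)"] Suc by simp
    finally have "(norm (c (x t) - y t))\<^sup>2 \<le> 2 * H / \<beta> 0"
      using \<beta>_pos[of 0] by (simp add: field_simps)
    then show ?thesis unfolding B_def by (simp add: add_increasing real_le_rsqrt)
  qed
  have "0 \<le> B" using B[of 0] norm_ge_zero order_trans by blast
  \<comment> \<open>Dividing \<open>2 * L\<close> by \<open>\<beta> 0\<close> makes the whole
    acceptance threshold proportional to \<open>1 / \<beta> t\<close>.\<close>
  define D where "D = 2 * L / \<beta> 0 + (M\<^sup>2 + 2 * B * L\<^sub>c)"
  have "0 < D"
    unfolding D_def using L_pos \<beta>_pos[of 0] M_pos L\<^sub>c_pos \<open>0 \<le> B\<close>
    by (intro add_pos_nonneg) auto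
  have small: "accepted f g c (\<beta> t) (x t) (y t) \<nu> v"
    if v: "v \<in> Argmin (subproblem f g c (\<beta> t) (x t) (y t) \<nu>)" and "0 < \<nu>" "\<nu> \<le> 1 / (D * \<beta> t)"
    for t \<nu> v
  proof (rule accepted_if_step_size_small[OF proper_g iterate_in_dom v \<open>0 < \<nu>\<close> \<beta>_pos f_diff grad_lip _
        c_diff convex_dom_hull dom_subset_hull Jac_lip Jac_bound _ M_pos B])
    have "2 * L / \<beta> 0 * \<beta> 0 \<le> 2 * L / \<beta> 0 * \<beta> t"
      using \<beta>_mono \<beta>_pos[of 0] L_pos by (intro mult_left_mono) (auto simp: incseq_def less_imp_le)
    then have "2 * L \<le> 2 * L / \<beta> 0 * \<beta> t" using \<beta>_pos[of 0] by simp
    then have "2 * L + \<beta> t * (M\<^sup>2 + 2 * B * L\<^sub>c) \<le> D * \<beta> t"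
      by (simp add: D_def algebra_simps)
    then have "\<nu> * (2 * L + \<beta> t * (M\<^sup>2 + 2 * B * L\<^sub>c)) \<le> 1 / (D * \<beta> t) * (D * \<beta> t)"
      using \<open>0 < \<nu>\<close> \<open>\<nu> \<le> 1 / (D * \<beta> t)\<close> \<open>0 < D\<close> \<beta>_pos[of t] L_pos L\<^sub>c_pos \<open>0 \<le> B\<close>
      by (intro mult_mono) auto
    also have "\<dots> = 1" using \<open>0 < D\<close> \<beta>_pos[of t] by simp
    finally show "\<nu> * (2 * L + \<beta> t * (M\<^sup>2 + 2 * B * L\<^sub>c)) \<le> 1" .
  qed (use L_pos L\<^sub>c_pos in auto)
  have step: "min (trial t) (\<rho> * (1 / (D * \<beta> t))) \<le> \<mu> t" for t
    using search_step_size_ge[OF search_step param(3,4) _ small] trial_step_size_bounds by blast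
  \<comment> \<open>The first entry covers the initial trial at \<open>t = 0\<close>, the second the
    backtracking floor.\<close>
  define k where "k = min (\<mu>\<^sub>0 * \<beta> 0) (\<rho> / D)"
  have "0 < k" unfolding k_def using param \<beta>_pos[of 0] \<open>0 < D\<close> by simp
  have \<rho>: "k / \<beta> t \<le> \<rho> * (1 / (D * \<beta> t))" for t
  proof -
    have "k / \<beta> t \<le> \<rho> / D / \<beta> t"
      using \<beta>_pos[of t] by (intro divide_right_mono) (auto simp: k_def)
    then show ?thesis by simp
  qed
  have "k / \<beta> t \<le> \<mu> t" for t
  proof (induction t)
    case 0
    have "k / \<beta> 0 \<le> \<mu>\<^sub>0"
      using \<beta>_pos[of 0] by (simp add: pos_divide_le_eq k_def)
    then show ?case using step[of 0] \<rho>[of 0] by (simp add: trial_def)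
  next
    case (Suc t)
    \<comment> \<open>The target \<open>k / \<beta> t\<close> does not grow with \<open>t\<close>,
      and by \<open>1 \<le> \<eta>\<close> the next search starts no lower than
      \<open>\<mu> t\<close>.\<close>
    have "k / \<beta> (Suc t) \<le> k / \<beta> t"
      using \<open>0 < k\<close> \<beta>_pos[of t] \<beta>_pos[of "Suc t"] \<beta>_mono
      by (intro divide_left_mono) (auto simp: incseq_SucD)
    then show ?case using Suc trial_Suc_ge[of t] step[of "Suc t"] \<rho>[of "Suc t"] by linarith
  qed
  with \<open>0 < k\<close> show thesis using that by blast
qed

section \<open>Descent of the potential\<close>

text \<open>The weight is that of the coming search, so acceptance test (b) applies
  directly.\<close>

definition potential :: "nat \<Rightarrow> real" where
  "potential t = f (x t) + real_of_ereal (g (x t))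
    + \<beta> t / 2 * (norm (c (x t) - y t))\<^sup>2 + real_of_ereal (h (y t))"

text \<open>Three changes in succession: test (b) moves \<open>x\<close> with \<open>y t\<close>
  fixed, the proximal step compared with \<open>y t\<close> moves \<open>y\<close>, and raising the
  weight adds the last term.\<close>

lemma potential_step:
  "potential (Suc t) \<le> potential t - 1 / (2 * \<mu> t) * (norm (x (Suc t) - x t))\<^sup>2
    + (\<beta> (Suc t) - \<beta> t) / 2 * (norm (c (x (Suc t)) - y (Suc t)))\<^sup>2"
proof -
  have "f (x (Suc t)) + real_of_ereal (g (x (Suc t))) + \<beta> t / 2 * (norm (c (x (Suc t)) - y t))\<^sup>2
      \<le> f (x t) + real_of_ereal (g (x t)) + \<beta> t / 2 * (norm (c (x t) - y t))\<^sup>2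
        - 1 / (2 * \<mu> t) * (norm (x (Suc t) - x t))\<^sup>2"
    using search_success(2)[OF search_step[of t]]
    unfolding accepted_iff[OF proper_g iterate_in_dom iterate_in_dom] by blast
  moreover note Prox_le[OF proper_h dom_h prox_step \<beta>_pos, of t "y t"]
  moreover have "\<beta> (Suc t) / 2 * (norm (c (x (Suc t)) - y (Suc t)))\<^sup>2
      = \<beta> t / 2 * (norm (c (x (Suc t)) - y (Suc t)))\<^sup>2
      + (\<beta> (Suc t) - \<beta> t) / 2 * (norm (c (x (Suc t)) - y (Suc t)))\<^sup>2"
    by (simp add: algebra_simps diff_divide_distrib)
  ultimately show ?thesis unfolding potential_def by linarith
qed

lemma continuous_real_g: "continuous_on (edom g) (\<lambda>z. real_of_ereal (g z))"
  using continuous_g proper_edom_finite[OF proper_g]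
  by (subst (asm) continuous_on_iff_real) (auto simp: comp_def)

lemma smooth_part_bounded:
  obtains lo hi where "\<And>t. lo \<le> f (x t) + real_of_ereal (g (x t))"
    and "\<And>t. f (x t) + real_of_ereal (g (x t)) \<le> hi"
proof -
  have "continuous_on (edom g) f"
    by (simp add: f_diff continuous_at_imp_continuous_on differentiable_imp_continuous_within)
  then have "continuous_on (edom g) (\<lambda>z. f z + real_of_ereal (g z))"
    using continuous_real_g by (rule continuous_on_add)
  moreover have "edom g \<noteq> {}" using iterate_in_dom by blast
  ultimately obtain a b
    where "\<forall>z\<in>edom g. f a + real_of_ereal (g a) \<le> f z + real_of_ereal (g z)"
      and "\<forall>z\<in>edom g. f z + real_of_ereal (g z) \<le> f b + real_of_ereal (g b)"
    using continuous_attains_inf[OF compact_dom_g] continuous_attains_sup[OF compact_dom_g]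
    by (metis (no_types, lifting))
  then show thesis using that iterate_in_dom by blast
qed

lemma small_step_in_window:
  obtains W where "0 \<le> W" and "\<And>T. 1 \<le> T
    \<Longrightarrow> \<exists>t\<in>{T..<2 * T}. 1 / (2 * \<mu> t) * (norm (x (Suc t) - x t))\<^sup>2 \<le> W / real T"
proof -
  obtain H where "0 < H"
    and H: "\<And>t. \<beta> t / 2 * (norm (c (x (Suc t)) - y (Suc t)))\<^sup>2 + real_of_ereal (h (y (Suc t))) \<le> H"
    using residual_bounded by metis
  obtain lo hi where lo: "\<And>t. lo \<le> f (x t) + real_of_ereal (g (x t))"
    and hi: "\<And>t. f (x t) + real_of_ereal (g (x t)) \<le> hi"
    using smooth_part_bounded by metis
  define r where "r = 2 * \<gamma>\<^sub>0 / \<alpha>\<^sub>0"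
  have "0 < r" unfolding r_def using growth_pos by simp
  \<comment> \<open>The weight increment is at most \<open>\<eta>\<^sub>0 / sqrt (t + 1)\<close> and
    half the squared residual at most \<open>H / (\<alpha>\<^sub>0 * sqrt (t + 1))\<close>; their
    product is \<open>E / (t + 1)\<close>.\<close>
  define E where "E = \<eta>\<^sub>0 * H / \<alpha>\<^sub>0"
  have "0 \<le> E" unfolding E_def using growth_pos \<open>0 < H\<close> by simp
  define e where "e t = (norm (c (x (Suc t)) - y (Suc t)))\<^sup>2" for t
  have e: "\<beta> t / 2 * e t \<le> H" for t
    using H[of t] h_nonneg[of "y (Suc t)"] by (simp add: e_def)
  have hy: "real_of_ereal (h (y (Suc t))) \<le> H" for t
    using H[of t] \<beta>_pos[of t] by (smt (verit) divide_nonneg_nonneg mult_nonneg_nonneg zero_le_power2)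
  have lower: "lo \<le> potential (Suc t)" for t
    unfolding potential_def using lo[of "Suc t"] h_nonneg[of "y (Suc t)"] \<beta>_pos[of "Suc t"]
    by (smt (verit) divide_nonneg_nonneg mult_nonneg_nonneg zero_le_power2)
  have upper: "potential (Suc t) \<le> hi + r * H + H" for t
  proof -
    have "\<beta> (Suc t) / 2 * e t \<le> (r * \<beta> t) / 2 * e t"
      using \<beta>_Suc_le[of t] by (intro mult_right_mono divide_right_mono) (auto simp: e_def r_def)
    also have "\<dots> = r * (\<beta> t / 2 * e t)" by simp
    also have "\<dots> \<le> r * H" using e \<open>0 < r\<close> by (intro mult_left_mono) auto
    finally show ?thesis
      unfolding potential_def using hi[of "Suc t"] hy[of t] by (simp add: e_def)
  qed
  have step: "potential (Suc t) \<le> potential t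
      - 1 / (2 * \<mu> t) * (norm (x (Suc t) - x t))\<^sup>2 + E / (real t + 1)" for t
  proof -
    have "\<alpha>\<^sub>0 * sqrt (real t + 1) / 2 * e t \<le> \<beta> t / 2 * e t"
      using \<beta>_ge[of t] by (intro mult_right_mono divide_right_mono) (auto simp: e_def)
    then have "\<alpha>\<^sub>0 * sqrt (real t + 1) * (e t / 2) \<le> H" using e[of t] by simp
    then have et: "e t / 2 \<le> H / (\<alpha>\<^sub>0 * sqrt (real t + 1))"
      using growth_pos by (simp add: pos_le_divide_eq mult.commute)
    have "(\<beta> (Suc t) - \<beta> t) / 2 * e t = (\<beta> (Suc t) - \<beta> t) * (e t / 2)" by simp
    also have "\<dots> \<le> \<eta>\<^sub>0 / sqrt (real t + 1) * (H / (\<alpha>\<^sub>0 * sqrt (real t + 1)))"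
      using \<beta>_increment_le[of t] et growth_pos by (intro mult_mono) (auto simp: e_def)
    also have "\<dots> = E / (sqrt (real t + 1) * sqrt (real t + 1))"
      by (simp add: E_def)
    also have "\<dots> = E / (real t + 1)" by simp
    finally show ?thesis using potential_step[of t] unfolding e_def by linarith
  qed
  have "0 \<le> hi + r * H + H - lo + E"
    using lower[of 0] upper[of 0] \<open>0 \<le> E\<close> by linarith
  moreover have "\<exists>t\<in>{T..<2 * T}. 1 / (2 * \<mu> t) * (norm (x (Suc t) - x t))\<^sup>2
      \<le> (hi + r * H + H - lo + E) / real T" if "1 \<le> T" for T
    by (rule exists_small_term_in_window[where \<phi> = potential, OF step lower upper \<open>0 \<le> E\<close> that])
  ultimately show thesis using that by blast
qed

section \<open>Stationarity and the complexity bound\<close>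

lemma stationary_point_if_small:
  fixes s :: nat
  defines "d \<equiv> norm (x (Suc (Suc s)) - x (Suc s))"
    and "e \<equiv> norm (c (x (Suc s)) - y (Suc s))"
  assumes grad_small: "L * d + 2 / \<mu> (Suc s) * d + \<eta>\<^sub>0 * M * e \<le> \<epsilon>\<^sub>1"
    and feas_small: "M * d + e \<le> \<epsilon>\<^sub>2" and step_small: "d \<le> \<epsilon>\<^sub>3"
  shows "stationary_point f g h c \<epsilon>\<^sub>1 \<epsilon>\<^sub>2 \<epsilon>\<^sub>3 (x (Suc (Suc s)))"
proof -
  \<comment> \<open>The multiplier \<open>w\<close> carries the penalty \<open>\<beta> s\<close> of the proximal step that produced \<open>y (Suc s)\<close>,
    whereas the \<open>x\<close>-subproblem uses \<open>\<beta> (Suc s)\<close>; the mismatch is the term with \<open>\<eta>\<^sub>0\<close>.\<close>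
  let ?t = "Suc s" and ?J = "transpose (Jac c (x (Suc s)))"
  let ?\<Delta> = "x (Suc ?t) - x ?t" and ?r = "c (x ?t) - y ?t"
  define u where "u = - (grad f (x ?t) + \<beta> ?t *\<^sub>R (?J *v ?r)) - (2 / \<mu> ?t) *\<^sub>R ?\<Delta>"
  define w where "w = \<beta> s *\<^sub>R ?r"
  have u: "u \<in> limiting_subdiff g (x (Suc ?t))"
    unfolding u_def
    by (rule Argmin_subproblem_subdiff[OF proper_g iterate_in_dom search_success(1)[OF search_step]])
  have w: "w \<in> limiting_subdiff h (y ?t)"
    unfolding w_def by (rule Prox_subdiff[OF proper_h dom_h prox_step \<beta>_pos])
  let ?v = "grad f (x (Suc ?t)) + u + ?J *v w"
  have v: "?v = (grad f (x (Suc ?t)) - grad f (x ?t)) - (2 / \<mu> ?t) *\<^sub>R ?\<Delta>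
      - (\<beta> ?t - \<beta> s) *\<^sub>R (?J *v ?r)"
    by (simp only: u_def w_def matrix_vector_mult_scaleR scaleR_diff_left) simp
  have "norm ?v \<le> norm (grad f (x (Suc ?t)) - grad f (x ?t)) + norm ((2 / \<mu> ?t) *\<^sub>R ?\<Delta>)
      + norm ((\<beta> ?t - \<beta> s) *\<^sub>R (?J *v ?r))"
    unfolding v by (rule order_trans[OF norm_triangle_ineq4 add_right_mono[OF norm_triangle_ineq4]])
  also have "norm (grad f (x (Suc ?t)) - grad f (x ?t)) \<le> L * d"
    unfolding d_def by (rule grad_lip)
  also have "norm ((2 / \<mu> ?t) *\<^sub>R ?\<Delta>) = 2 / \<mu> ?t * d"
    using step_size_pos[of ?t] by (simp add: d_def)
  also have "norm ((\<beta> ?t - \<beta> s) *\<^sub>R (?J *v ?r)) \<le> \<eta>\<^sub>0 * (M * e)"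
  proof -
    \<comment> \<open>A constant bound on the weight increment suffices, as it multiplies the small
      residual.\<close>
    have "\<eta>\<^sub>0 / sqrt (real s + 1) \<le> \<eta>\<^sub>0 / 1"
      using growth_pos by (intro divide_left_mono) auto
    then have "\<bar>\<beta> ?t - \<beta> s\<bar> \<le> \<eta>\<^sub>0"
      using \<beta>_increment_le[of s] \<beta>_increment_nonneg[of s] by linarith
    moreover have "norm (?J *v ?r) \<le> M * e"
    proof -
      have "norm (?J *v ?r) \<le> opnorm (Jac c (x ?t)) * e"
        unfolding e_def by (rule norm_transpose_matrix_vector_le_opnorm)
      also have "\<dots> \<le> M * e"
        using Jac_bound[of "x ?t"] iterate_in_dom dom_subset_hull
        by (intro mult_right_mono) (auto simp: e_def)
      finally show ?thesis .
    qed
    ultimately show ?thesis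
      unfolding norm_scaleR using growth_pos by (intro mult_mono) auto
  qed
  finally have "norm ?v \<le> \<epsilon>\<^sub>1" using grad_small by simp
  \<comment> \<open>The witnesses for \<open>y\<close> and \<open>z\<close> are
    \<open>y (Suc s)\<close> and the previous iterate \<open>x (Suc s)\<close>, at which the
    Jacobian was evaluated; \<open>M * d\<close> in the feasibility bound pays for this
    shift.\<close>
  then have dist: "edist_set 0 {grad f (x (Suc ?t)) + u + ?J *v w | u w.
      u \<in> limiting_subdiff g (x (Suc ?t)) \<and> w \<in> limiting_subdiff h (y ?t)} \<le> ereal \<epsilon>\<^sub>1"
    unfolding edist_set_def using u w by (intro INF_lower2[of ?v]) auto
  have "norm (c (x (Suc ?t)) - c (x ?t)) \<le> M * d"
    unfolding d_def
    by (rule norm_diff_le_of_opnorm_le[OF c_diff convex_dom_hull _ _ Jac_bound])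
      (use iterate_in_dom dom_subset_hull in auto)
  then have "norm (c (x (Suc ?t)) - y ?t) \<le> \<epsilon>\<^sub>2"
    using norm_triangle_ineq[of "c (x (Suc ?t)) - c (x ?t)" ?r] feas_small by (simp add: e_def)
  then show ?thesis
    unfolding stationary_point_def using dist step_small iterate_in_dom d_def by blast
qed

text \<open>The squared ratio of step to step size is the potential decrease, of order
  \<open>1 / T\<close>, times \<open>2 / \<mu> t\<close>, of order \<open>sqrt T\<close>. The
  squared residual is of order \<open>1 / \<beta> s\<close>, so both rates agree.\<close>

lemma residual_and_step_rate:
  obtains N where "0 < N" and "\<And>T. 1 \<le> T \<Longrightarrow> \<exists>s. T \<le> Suc s \<and> Suc s < 2 * T
    \<and> (norm (c (x (Suc s)) - y (Suc s)))\<^sup>2 \<le> N / sqrt (real T)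
    \<and> (norm (x (Suc (Suc s)) - x (Suc s)) / \<mu> (Suc s))\<^sup>2 \<le> N / sqrt (real T)"
proof -
  obtain H where "0 < H"
    and H: "\<And>t. \<beta> t / 2 * (norm (c (x (Suc t)) - y (Suc t)))\<^sup>2 + real_of_ereal (h (y (Suc t))) \<le> H"
    using residual_bounded by metis
  obtain W where "0 \<le> W" and W: "\<And>T. 1 \<le> T
    \<Longrightarrow> \<exists>t\<in>{T..<2 * T}. 1 / (2 * \<mu> t) * (norm (x (Suc t) - x t))\<^sup>2 \<le> W / real T"
    using small_step_in_window by metis
  obtain k where "0 < k" and k: "\<And>t. k / \<beta> t \<le> \<mu> t"
    using step_size_lower_bound by metis
  define P where "P = 2 * H / \<alpha>\<^sub>0"
  define Q where "Q = 4 * W * \<gamma>\<^sub>0 / k"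
  have "0 < P" "0 \<le> Q"
    unfolding P_def Q_def using \<open>0 < H\<close> \<open>0 \<le> W\<close> \<open>0 < k\<close> growth_pos by auto
  have "\<exists>s. T \<le> Suc s \<and> Suc s < 2 * T
    \<and> (norm (c (x (Suc s)) - y (Suc s)))\<^sup>2 \<le> (P + Q) / sqrt (real T)
    \<and> (norm (x (Suc (Suc s)) - x (Suc s)) / \<mu> (Suc s))\<^sup>2 \<le> (P + Q) / sqrt (real T)"
    if T: "1 \<le> T" for T
  proof -
    obtain t where t: "t \<in> {T..<2 * T}"
      and small: "1 / (2 * \<mu> t) * (norm (x (Suc t) - x t))\<^sup>2 \<le> W / real T"
      using W[OF T] by blast
    \<comment> \<open>The residual at index \<open>t\<close> stems from the proximal step with
      weight \<open>\<beta> s\<close>, one index earlier.\<close>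
    obtain s where s: "t = Suc s" using t T by (cases t) auto
    have Tpos: "0 < sqrt (real T)" using T by simp
    let ?e = "norm (c (x (Suc s)) - y (Suc s))"
    have "\<alpha>\<^sub>0 * sqrt (real T) / 2 * ?e\<^sup>2 \<le> \<beta> s / 2 * ?e\<^sup>2"
    proof (intro mult_right_mono divide_right_mono)
      have "\<alpha>\<^sub>0 * sqrt (real T) \<le> \<alpha>\<^sub>0 * sqrt (real s + 1)"
        using t s growth_pos by (intro mult_left_mono real_sqrt_le_mono) auto
      then show "\<alpha>\<^sub>0 * sqrt (real T) \<le> \<beta> s" using \<beta>_ge[of s] by linarith
    qed auto
    also have "\<dots> \<le> H" using H[of s] h_nonneg[of "y (Suc s)"] by simp
    finally have "?e\<^sup>2 \<le> P / sqrt (real T)"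
      using growth_pos Tpos by (simp add: P_def field_simps)
    moreover have "P / sqrt (real T) \<le> (P + Q) / sqrt (real T)"
      using \<open>0 \<le> Q\<close> by (intro divide_right_mono) auto
    ultimately have e: "?e\<^sup>2 \<le> (P + Q) / sqrt (real T)" by linarith
    have "1 / \<mu> t \<le> \<beta> t / k"
      using k[of t] \<open>0 < k\<close> \<beta>_pos[of t] step_size_pos[of t] by (simp add: field_simps)
    also have "\<dots> \<le> 2 * \<gamma>\<^sub>0 * sqrt (real T) / k"
    proof (intro divide_right_mono)
      have "sqrt (real t + 1) \<le> sqrt (2\<^sup>2 * real T)"
        using t by (intro real_sqrt_le_mono) auto
      also have "\<dots> = 2 * sqrt (real T)" by (simp only: real_sqrt_mult) simp
      finally have "\<gamma>\<^sub>0 * sqrt (real t + 1) \<le> \<gamma>\<^sub>0 * (2 * sqrt (real T))"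
        using growth_pos by (intro mult_left_mono) auto
      then show "\<beta> t \<le> 2 * \<gamma>\<^sub>0 * sqrt (real T)" using \<beta>_le[of t] by simp
    qed (use \<open>0 < k\<close> in auto)
    finally have \<mu>: "1 / \<mu> t \<le> 2 * \<gamma>\<^sub>0 * sqrt (real T) / k" .
    have "(norm (x (Suc t) - x t) / \<mu> t)\<^sup>2
        = (1 / (2 * \<mu> t) * (norm (x (Suc t) - x t))\<^sup>2) * (2 * (1 / \<mu> t))"
      by (simp add: power_divide power2_eq_square)
    also have "\<dots> \<le> W / real T * (2 * (2 * \<gamma>\<^sub>0 * sqrt (real T) / k))"
      using small \<mu> \<open>0 \<le> W\<close> step_size_pos[of t]
      by (intro mult_mono mult_left_mono) (auto simp: less_imp_le)
    also have "\<dots> = Q * (sqrt (real T) / real T)"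
      by (simp add: Q_def mult_ac)
    also have "sqrt (real T) / real T = 1 / sqrt (real T)"
      by (simp add: sqrt_divide_self_eq inverse_eq_divide)
    finally have "(norm (x (Suc t) - x t) / \<mu> t)\<^sup>2 \<le> Q / sqrt (real T)" by simp
    moreover have "Q / sqrt (real T) \<le> (P + Q) / sqrt (real T)"
      using \<open>0 < P\<close> by (intro divide_right_mono) auto
    ultimately have "(norm (x (Suc t) - x t) / \<mu> t)\<^sup>2 \<le> (P + Q) / sqrt (real T)" by linarith
    then show ?thesis using e t s by (intro exI[of _ s]) auto
  qed
  moreover have "0 < P + Q" using \<open>0 < P\<close> \<open>0 \<le> Q\<close> by simp
  ultimately show thesis using that by blast
qed

lemma iteration_complexity:
  "\<exists>C>0. \<forall>\<epsilon>. 0 < \<epsilon> \<and> \<epsilon> < 1 \<longrightarrow> (\<exists>t::nat. 1 \<le> t \<and> real t \<le> C / \<epsilon> ^ 4 \<and>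
     stationary_point f g h c \<epsilon> \<epsilon> \<epsilon> (x (t + 1)))"
proof -
  obtain N where "0 < N" and N: "\<And>T. 1 \<le> T \<Longrightarrow> \<exists>s. T \<le> Suc s \<and> Suc s < 2 * T
    \<and> (norm (c (x (Suc s)) - y (Suc s)))\<^sup>2 \<le> N / sqrt (real T)
    \<and> (norm (x (Suc (Suc s)) - x (Suc s)) / \<mu> (Suc s))\<^sup>2 \<le> N / sqrt (real T)"
    using residual_and_step_rate by metis
  have "0 < \<mu>\<^sub>m\<^sub>a\<^sub>x" using param by linarith
  \<comment> \<open>The sum of the coefficients in the three stationarity bounds; residual and ratio
    at most \<open>\<epsilon> / A\<close> then satisfy all three at once.\<close>
  define A where "A = (L * \<mu>\<^sub>m\<^sub>a\<^sub>x + 2 + \<eta>\<^sub>0 * M) + (M * \<mu>\<^sub>m\<^sub>a\<^sub>x + 1) + \<mu>\<^sub>m\<^sub>a\<^sub>x"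
  have nonneg: "0 \<le> L * \<mu>\<^sub>m\<^sub>a\<^sub>x" "0 \<le> \<eta>\<^sub>0 * M" "0 \<le> M * \<mu>\<^sub>m\<^sub>a\<^sub>x"
    using L_pos M_pos growth_pos \<open>0 < \<mu>\<^sub>m\<^sub>a\<^sub>x\<close> by auto
  have "0 < A" unfolding A_def using nonneg \<open>0 < \<mu>\<^sub>m\<^sub>a\<^sub>x\<close> by linarith
  define R where "R = A\<^sup>2 * N"
  have "0 < R" unfolding R_def using \<open>0 < A\<close> \<open>0 < N\<close> by simp
  have "\<exists>t::nat. 1 \<le> t \<and> real t \<le> (2 * R\<^sup>2 + 2) / \<epsilon> ^ 4 \<and>
     stationary_point f g h c \<epsilon> \<epsilon> \<epsilon> (x (t + 1))" if \<epsilon>: "0 < \<epsilon>" "\<epsilon> < 1" for \<epsilon>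
  proof -
    \<comment> \<open>Chosen so that \<open>sqrt T\<close> is at least
      \<open>R / \<epsilon>\<^sup>2\<close>, which makes \<open>N / sqrt T\<close> at most
      \<open>(\<epsilon> / A)\<^sup>2\<close>.\<close>
    define T where "T = nat \<lceil>R\<^sup>2 / \<epsilon> ^ 4\<rceil>"
    have pos: "0 < R\<^sup>2 / \<epsilon> ^ 4" using \<open>0 < R\<close> \<epsilon> by simp
    have T: "1 \<le> T" "R\<^sup>2 / \<epsilon> ^ 4 \<le> real T" "real T \<le> R\<^sup>2 / \<epsilon> ^ 4 + 1"
      unfolding T_def using pos by linarith+
    obtain s where s: "T \<le> Suc s" "Suc s < 2 * T"
      and e: "(norm (c (x (Suc s)) - y (Suc s)))\<^sup>2 \<le> N / sqrt (real T)"
      and p: "(norm (x (Suc (Suc s)) - x (Suc s)) / \<mu> (Suc s))\<^sup>2 \<le> N / sqrt (real T)"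
      using N[OF T(1)] by blast
    have "(R / \<epsilon>\<^sup>2)\<^sup>2 \<le> real T"
      using T(2) by (simp add: power_divide flip: power_mult)
    then have "R / \<epsilon>\<^sup>2 \<le> sqrt (real T)" by (rule real_le_rsqrt)
    then have "N / sqrt (real T) \<le> N / (R / \<epsilon>\<^sup>2)"
      using \<open>0 < N\<close> \<open>0 < R\<close> \<epsilon> T(1) by (intro divide_left_mono) auto
    also have "\<dots> = (\<epsilon> / A)\<^sup>2"
      using \<open>0 < N\<close> \<open>0 < A\<close> \<epsilon> by (simp add: R_def power_divide)
    finally have rate: "N / sqrt (real T) \<le> (\<epsilon> / A)\<^sup>2" .
    define m where "m = \<epsilon> / A"
    have "0 < m" unfolding m_def using \<epsilon> \<open>0 < A\<close> by simp
    define d where "d = norm (x (Suc (Suc s)) - x (Suc s))"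
    define e' where "e' = norm (c (x (Suc s)) - y (Suc s))"
    have e': "e' \<le> m"
      using e rate \<open>0 < m\<close> unfolding e'_def m_def by (meson less_imp_le order_trans power2_le_imp_le)
    have p': "d / \<mu> (Suc s) \<le> m"
      using p rate \<open>0 < m\<close> unfolding d_def m_def by (meson less_imp_le order_trans power2_le_imp_le)
    have d: "d \<le> \<mu>\<^sub>m\<^sub>a\<^sub>x * m"
    proof -
      have "d = \<mu> (Suc s) * (d / \<mu> (Suc s))" using step_size_pos[of "Suc s"] by simp
      also have "\<dots> \<le> \<mu>\<^sub>m\<^sub>a\<^sub>x * m"
        using p' step_size_le[of "Suc s"] step_size_pos[of "Suc s"] \<open>0 < \<mu>\<^sub>m\<^sub>a\<^sub>x\<close>
        by (intro mult_mono) (auto simp: d_def)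
      finally show ?thesis .
    qed
    have Am: "A * m = \<epsilon>" unfolding m_def using \<open>0 < A\<close> by simp
    have parts: "(L * \<mu>\<^sub>m\<^sub>a\<^sub>x + 2 + \<eta>\<^sub>0 * M) * m \<le> \<epsilon>" "(M * \<mu>\<^sub>m\<^sub>a\<^sub>x + 1) * m \<le> \<epsilon>" "\<mu>\<^sub>m\<^sub>a\<^sub>x * m \<le> \<epsilon>"
      unfolding Am[symmetric] using \<open>0 < m\<close> nonneg \<open>0 < \<mu>\<^sub>m\<^sub>a\<^sub>x\<close>
      by (auto intro!: mult_right_mono simp: A_def)
    have "stationary_point f g h c \<epsilon> \<epsilon> \<epsilon> (x (Suc (Suc s)))"
    proof (rule stationary_point_if_small, fold d_def e'_def)
      have Ld: "L * d \<le> L * (\<mu>\<^sub>m\<^sub>a\<^sub>x * m)" and Md: "M * d \<le> M * (\<mu>\<^sub>m\<^sub>a\<^sub>x * m)"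
        and Me: "\<eta>\<^sub>0 * M * e' \<le> \<eta>\<^sub>0 * M * m"
        using d e' L_pos M_pos growth_pos by (auto intro!: mult_left_mono)
      have "2 / \<mu> (Suc s) * d \<le> 2 * m" using p' by simp
      with Ld Me parts(1) show "L * d + 2 / \<mu> (Suc s) * d + \<eta>\<^sub>0 * M * e' \<le> \<epsilon>"
        by (simp add: algebra_simps)
      show "M * d + e' \<le> \<epsilon>" using Md e' parts(2) by (simp add: algebra_simps)
      show "d \<le> \<epsilon>" using d parts(3) by linarith
    qed
    moreover have "real (Suc s) \<le> (2 * R\<^sup>2 + 2) / \<epsilon> ^ 4"
    proof -
      have "real (Suc s) \<le> 2 * real T" using s by linarith
      also have "\<dots> \<le> 2 * (R\<^sup>2 / \<epsilon> ^ 4) + 2 * 1" using T(3) by linarith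
      \<comment> \<open>The rounding in \<open>T\<close> is absorbed into the rate since \<epsilon>
        is below 1.\<close>
      also have "1 \<le> 1 / \<epsilon> ^ 4" using \<epsilon> by (simp add: power_le_one)
      finally show ?thesis by (simp add: add_divide_distrib)
    qed
    ultimately show ?thesis by (intro exI[of _ "Suc s"]) auto
  qed
  moreover have "0 < 2 * R\<^sup>2 + 2" by (simp add: add_nonneg_pos)
  ultimately show ?thesis by blast
qed

end

theorem mainTheorem5:
  fixes f :: "real^'n \<Rightarrow> real" and g :: "real^'n \<Rightarrow> ereal"
    and h :: "real^'m \<Rightarrow> ereal" and c :: "real^'n \<Rightarrow> real^'m"
    and \<mu>\<^sub>m\<^sub>a\<^sub>x \<mu>\<^sub>0 \<rho> \<eta> \<alpha>\<^sub>0 \<gamma>\<^sub>0 \<eta>\<^sub>0 :: real and \<beta> \<mu> :: "nat \<Rightarrow> real"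
    and x :: "nat \<Rightarrow> real^'n" and y :: "nat \<Rightarrow> real^'m"
  assumes "standing_assumption f g h c"
    and "edom h = UNIV"
    and "compact (edom g)"
    and "sdcam_parameters \<mu>\<^sub>m\<^sub>a\<^sub>x \<mu>\<^sub>0 \<rho> \<eta> \<beta>"
    and "growth_condition (1 / 2) \<alpha>\<^sub>0 \<gamma>\<^sub>0 \<eta>\<^sub>0 \<beta>"
    and "sdcam_generated f g h c \<mu>\<^sub>m\<^sub>a\<^sub>x \<mu>\<^sub>0 \<rho> \<eta> \<beta> x y \<mu>"
  shows "\<exists>C>0. \<exists>\<kappa>\<ge>0. \<forall>\<epsilon>. 0 < \<epsilon> \<and> \<epsilon> < 1 / 2 \<longrightarrow>
    (\<exists>t::nat. 1 \<le> t \<and> int t \<le> \<lceil>C * \<epsilon> powr (-4) * ln (1 / \<epsilon>) powr \<kappa>\<rceil> \<and>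
       stationary_point f g h c \<epsilon> \<epsilon> \<epsilon> (x (t + 1)))"
proof -
  obtain L where L: "0 < L" "\<forall>x z. norm (grad f x - grad f z) \<le> L * norm (x - z)"
    using assms(1) unfolding standing_assumption_def by blast
  obtain L\<^sub>c M where c: "0 < L\<^sub>c" "0 < M"
    "\<forall>x \<in> closure (convex hull (edom g)). \<forall>z \<in> closure (convex hull (edom g)).
        opnorm (Jac c x - Jac c z) \<le> L\<^sub>c * norm (x - z) \<and> opnorm (Jac c x) \<le> M"
    using assms(1) unfolding standing_assumption_def by blast
  interpret sdcam_run f g h c \<mu>\<^sub>m\<^sub>a\<^sub>x \<mu>\<^sub>0 \<rho> \<eta> \<alpha>\<^sub>0 \<gamma>\<^sub>0 \<eta>\<^sub>0 L L\<^sub>c M \<beta> \<mu> x y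
    by unfold_locales (use assms L c in auto)
  obtain C where "0 < C" and C: "\<And>\<epsilon>. 0 < \<epsilon> \<Longrightarrow> \<epsilon> < 1 \<Longrightarrow> \<exists>t::nat. 1 \<le> t \<and> real t \<le> C / \<epsilon> ^ 4 \<and>
     stationary_point f g h c \<epsilon> \<epsilon> \<epsilon> (x (t + 1))"
    using iteration_complexity by blast
  have "\<exists>t::nat. 1 \<le> t \<and> int t \<le> \<lceil>C * \<epsilon> powr (-4) * ln (1 / \<epsilon>) powr 0\<rceil> \<and>
       stationary_point f g h c \<epsilon> \<epsilon> \<epsilon> (x (t + 1))" if \<epsilon>: "0 < \<epsilon>" "\<epsilon> < 1 / 2" for \<epsilon>
  proof -
    obtain t :: nat where t: "1 \<le> t" "real t \<le> C / \<epsilon> ^ 4" "stationary_point f g h c \<epsilon> \<epsilon> \<epsilon> (x (t + 1))"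
      using C[of \<epsilon>] \<epsilon> by auto
    \<comment> \<open>The base must be nonzero because \<open>0 powr 0 = 0\<close>; here \<epsilon>
      is below \<open>1 / 2\<close>, so the logarithm is positive.\<close>
    have "ln (1 / \<epsilon>) powr 0 = 1" using \<epsilon> by simp
    moreover have "\<epsilon> powr (-4) = 1 / \<epsilon> ^ 4"
      using \<epsilon> by (simp add: powr_minus_divide)
    ultimately have "C * \<epsilon> powr (-4) * ln (1 / \<epsilon>) powr 0 = C / \<epsilon> ^ 4" by simp
    moreover have "int t \<le> \<lceil>C / \<epsilon> ^ 4\<rceil>" using t(2) by linarith
    ultimately show ?thesis using t by auto
  qed
  with \<open>0 < C\<close> show ?thesis by blast
qed

end
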